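(* Let $d\ge 3$ and $j\ge 0$ be integers. The generalized Funk--Radon transform $\mathcal S^{(j)}_d$ on $C^\infty(\mathbb S^{d-1})$ satisfies the eigenvalue decomposition $$\mathcal S^{(j)}_d Y_{n,d}^k=\hat{\mathcal S}^{(j)}_d(n)\,Y_{n,d}^k,\qquad n\in\mathbb N_0,\; k=1,\dots,N_{n,d},$$ where, if $n+j$ is even and ($n\ge j-d+3$ or $d$ is even), $$\hat{\mathcal S}^{(j)}_d(n)=|\mathbb S^{d-2}|\,(-1)^{\frac{n+j}{2}}\,\frac{(n+j-1)!!\,(d-3)!!}{(n-j+d-3)!!}=\pi^{\frac{d-2}{2}}\,(-1)^{\frac{n+j}{2}}\,2^{j+1}\,\frac{\Gamma\left(\frac{n+j+1}{2}\right)}{\Gamma\left(\frac{n-j+d-1}{2}\right)},$$ and $\hat{\mathcal S}^{(j)}_d(n)=0$ otherwise.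
   Context: $\mathbb S^{d-1}=\{x\in\mathbb R^d:\|x\|=1\}$, and $|\mathbb S^{d-1}|=2\pi^{d/2}/\Gamma(d/2)$ is its surface measure. For $f\in C^\infty(\mathbb S^{d-1})$ the generalized Funk--Radon transform is $\mathcal S^{(j)}_d f(\xi)=\int_{\mathbb S^{d-1}}\delta^{(j)}(\xi^\top\eta)f(\eta)\,d\eta$, $\xi\in\mathbb S^{d-1}$, where $\delta^{(j)}$ is the $j$-th derivative of the Dirac delta ($\int_{-1}^1\delta^{(j)}(t)\psi(t)\,dt=(-1)^j\psi^{(j)}(0)$). This means precisely $$\mathcal S^{(j)}_d f(\xi)=(-1)^j\left(\frac{d}{dt}\right)^j\left[(1-t^2)^{-1/2}\int_{\{\eta\in\mathbb S^{d-1}:\,\xi^\top\eta=t\}}f(\eta)\,d\lambda(\eta)\right]_{t=0},$$ where $d\lambda$ is the standard $(d-2)$-dimensional surface measure on the sub-sphere. $\mathscr Y_{n,d}(\mathbb S^{d-1})$ is the space of restrictions to $\mathbb S^{d-1}$ of harmonic polynomials homogeneous of degree $n$; its dimension is $N_{n,d}=\frac{(2n+d-2)(n+d-3)!}{n!\,(d-2)!}$, and $Y_{n,d}^k$, $k=1,\dots,N_{n,d}$, is an orthonormal basis of it in $L^2(\mathbb S^{d-1})$. Double factorials: $n!!=n(n-2)\cdots$ down to $2$ or $1$, $0!!=(-1)!!=1$; for negative odd integers $n!!$ is defined by the recursion $n!!=n\,(n-2)!!$. The Gamma function is extended to negative half-integers by $\Gamma(x+1)=x\Gamma(x)$. *)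

theory Defs
  imports "HOL-Analysis.Analysis"
begin

section \<open>Surface measures on spheres and sub-spheres\<close>

text \<open>
  Lebesgue measure of a linear subspace \<open>V\<close> of Euclidean space, as a Borel measure on the ambient
  space carried by \<open>V\<close>.  By Fubini, the tube of radius 1 around a Borel set \<open>B \<subseteq> V\<close>, orthogonal
  to \<open>V\<close>, has volume (measure of \<open>B\<close>) times (volume of the unit ball of the orthogonal complement);
  \<open>closest_point V\<close> is the orthogonal projection onto \<open>V\<close>.
\<close>

definition subspace_lebesgue :: "'a::euclidean_space set \<Rightarrow> 'a measure" where
  "subspace_lebesgue V =
     scale_measure (ennreal (1 / unit_ball_vol (real (DIM('a) - dim V))))
       (distr (restrict_space lborel {x. dist x (closest_point V x) \<le> 1}) borel (closest_point V))"

text \<open>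
  Surface measure on the sphere \<open>{c + y | y. y \<in> V \<and> norm y = r}\<close> of dimension \<open>dim V - 1\<close>, for
  \<open>r > 0\<close>.  In an \<open>m\<close>-dimensional space the cone with apex \<open>c\<close> over a Borel subset \<open>A\<close> of the sphere
  has volume \<open>r / m\<close> times the surface measure of \<open>A\<close>; so the surface measure is \<open>m / r\<close> times the
  image of the volume on the ball under radial projection.
\<close>

definition sphere_measure :: "'a::euclidean_space set \<Rightarrow> 'a \<Rightarrow> real \<Rightarrow> 'a measure" where
  "sphere_measure V c r =
     scale_measure (ennreal (real (dim V) / r))
       (distr (restrict_space (subspace_lebesgue V) (cball 0 r)) borel
          (\<lambda>y. c + (r / norm y) *\<^sub>R y))"

definition unit_sphere_measure :: "'a::euclidean_space measure" where
  "unit_sphere_measure = sphere_measure UNIV 0 1"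

text \<open>
  For \<open>norm \<xi> = 1\<close> and \<open>\<bar>t\<bar> < 1\<close>, the set \<open>{\<eta>. norm \<eta> = 1 \<and> \<xi> \<bullet> \<eta> = t}\<close> is the sphere with centre
  \<open>t *\<^sub>R \<xi>\<close> and radius \<open>sqrt (1 - t\<^sup>2)\<close> in the affine hyperplane \<open>\<xi> \<bullet> \<eta> = t\<close>.
\<close>

definition subsphere_measure :: "'a::euclidean_space \<Rightarrow> real \<Rightarrow> 'a measure" where
  "subsphere_measure \<xi> t = sphere_measure {y. \<xi> \<bullet> y = 0} (t *\<^sub>R \<xi>) (sqrt (1 - t\<^sup>2))"

text \<open>The total surface measure of the unit sphere in \<open>m\<close>-dimensional Euclidean space.\<close>

definition sphere_area :: "nat \<Rightarrow> real" where
  "sphere_area m = 2 * pi powr (real m / 2) / Gamma (real m / 2)"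


section \<open>The generalized Funk--Radon transform\<close>

definition nth_vector_derivative ::
    "nat \<Rightarrow> (real \<Rightarrow> 'b::real_normed_vector) \<Rightarrow> real \<Rightarrow> 'b" where
  "nth_vector_derivative j = (\<lambda>g t. vector_derivative g (at t)) ^^ j"

text \<open>
  Meaningful for \<open>\<xi>\<close> on the unit sphere and \<open>f\<close> smooth on the unit sphere; only the values of \<open>f\<close>
  on the sphere matter.
\<close>

definition funk_radon :: "nat \<Rightarrow> ('a::euclidean_space \<Rightarrow> complex) \<Rightarrow> 'a \<Rightarrow> complex" where
  "funk_radon j f \<xi> =
     (- 1) ^ j *
     nth_vector_derivative j
       (\<lambda>t. (1 / sqrt (1 - t\<^sup>2)) *\<^sub>R (LINT \<eta>|subsphere_measure \<xi> t. f \<eta>)) 0"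


section \<open>Spherical harmonics\<close>

definition directional_derivative ::
    "'a::real_normed_vector \<Rightarrow> ('a \<Rightarrow> complex) \<Rightarrow> 'a \<Rightarrow> complex" where
  "directional_derivative b p x = vector_derivative (\<lambda>s. p (x + s *\<^sub>R b)) (at 0)"

definition laplacian :: "('a::euclidean_space \<Rightarrow> complex) \<Rightarrow> 'a \<Rightarrow> complex" where
  "laplacian p x = (\<Sum>b\<in>Basis. directional_derivative b (directional_derivative b p) x)"

definition spherical_harmonics :: "nat \<Rightarrow> ('a::euclidean_space \<Rightarrow> complex) set" where
  "spherical_harmonics n =
     {restrict p (sphere 0 1) | p.
        polynomial_function p \<and>
        (\<forall>x. laplacian p x = 0) \<and>
        (\<forall>c::real. \<forall>x. p (c *\<^sub>R x) = of_real c ^ n * p x)}"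

text \<open>
  The dimension of \<open>spherical_harmonics n\<close> over the unit sphere of \<open>d\<close>-dimensional space,
  for \<open>d \<ge> 3\<close>; the division is exact.
\<close>

definition harmonics_dim :: "nat \<Rightarrow> nat \<Rightarrow> nat" where
  "harmonics_dim n d = ((2 * n + d - 2) * fact (n + d - 3)) div (fact n * fact (d - 2))"

definition L2_inner :: "('a::euclidean_space \<Rightarrow> complex) \<Rightarrow> ('a \<Rightarrow> complex) \<Rightarrow> complex" where
  "L2_inner f g = (LINT \<eta>|unit_sphere_measure. f \<eta> * cnj (g \<eta>))"

definition orthonormal_harmonic_basis ::
    "nat \<Rightarrow> (nat \<Rightarrow> 'a::euclidean_space \<Rightarrow> complex) \<Rightarrow> bool" where
  "orthonormal_harmonic_basis n Y \<longleftrightarrow>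
     (let K = {1..harmonics_dim n DIM('a)} in
       (\<forall>k\<in>K. Y k \<in> spherical_harmonics n) \<and>
       (\<forall>k\<in>K. \<forall>l\<in>K. L2_inner (Y k) (Y l) = (if k = l then 1 else 0)) \<and>
       (\<forall>f\<in>spherical_harmonics n. \<exists>c. \<forall>x\<in>sphere 0 1. f x = (\<Sum>k\<in>K. c k * Y k x)))"


section \<open>Eigenvalues\<close>

text \<open>
  The last two branches extend the double factorial to negative odd integers by the recursion
  \<open>n!! = n * (n - 2)!!\<close>, read as \<open>n!! = (n + 2)!! / (n + 2)\<close>; for even integers below \<open>0\<close> it is
  not defined.
\<close>

function double_fact :: "int \<Rightarrow> real" where
  "double_fact n =
     (if n \<ge> 1 then of_int n * double_fact (n - 2)
      else if n = 0 \<or> n = - 1 then 1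
      else if odd n then double_fact (n + 2) / of_int (n + 2)
      else undefined)"
  by auto
termination
proof (relation "Wellfounded.measure (\<lambda>n. if n \<ge> - 1 then nat (n + 2) else nat (- n))")
  fix n :: int
  assume "\<not> n \<ge> 1" "\<not> (n = 0 \<or> n = - 1)" "odd n"
  then have "n \<le> - 3" by presburger
  then show "(n + 2, n) \<in> Wellfounded.measure (\<lambda>n. if n \<ge> - 1 then nat (n + 2) else nat (- n))"
    by auto
qed auto

declare double_fact.simps [simp del]

definition eigenvalue_cond :: "nat \<Rightarrow> nat \<Rightarrow> nat \<Rightarrow> bool" where
  "eigenvalue_cond d j n \<longleftrightarrow> even (n + j) \<and> (int n \<ge> int j - int d + 3 \<or> even d)"

definition funk_radon_eigenvalue :: "nat \<Rightarrow> nat \<Rightarrow> nat \<Rightarrow> real" where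
  "funk_radon_eigenvalue d j n =
     (if eigenvalue_cond d j n then
        sphere_area (d - 1) * (- 1) ^ ((n + j) div 2) *
        (double_fact (int n + int j - 1) * double_fact (int d - 3) /
         double_fact (int n - int j + int d - 3))
      else 0)"

end

theory Submission
  imports Defs
begin

text \<open>
  Let \<open>p\<close> be a harmonic polynomial, homogeneous of degree \<open>n\<close>, in dimension \<open>d\<close>, and let \<open>\<xi>\<close> be a unit
  vector.  Scaling the sub-sphere at height \<open>t\<close> to the equator \<open>\<xi> \<bullet> \<omega> = 0\<close>, whose surface measure is
  \<open>\<sigma>\<close>, turns the function to be differentiated into \<open>G t = (1 - t\<^sup>2) powr ((d - 3) / 2) * P t\<close> with
  \<open>P t = (LINT \<omega>|\<sigma>. p (t *\<^sub>R \<xi> + sqrt (1 - t\<^sup>2) *\<^sub>R \<omega>))\<close>.  Write \<open>P1\<close> and \<open>P2\<close> for the same integrals of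
  the first and second derivative of \<open>p\<close> in direction \<open>\<xi>\<close>; these derivatives are again harmonic and
  homogeneous, so everything below applies to them too.

  Two relations hold.  By Euler's identity for homogeneous functions, \<open>(1 - t\<^sup>2) P' = P1 - n t P\<close>
  (\<open>slice_integral_deriv\<close>).  The measure \<open>\<sigma>\<close> is invariant under the rotations that fix \<open>\<xi>\<close>, so the
  second-order operators \<open>A\<^sup>2\<close>, for \<open>A\<close> an infinitesimal rotation of the equatorial hyperplane, integrate to
  zero.  Summed over all coordinate planes they form the Laplacian of the equator; together with harmonicity
  and Euler's identity this gives \<open>P2 = (2 n + d - 4) t P1 - n (n + d - 3) P\<close>
  (\<open>slice_integral_gegenbauer\<close>).

  The two relations amount to the differential equation
  \<open>(1 - t\<^sup>2) G'' + (d - 5) t G' + (n + 1) (n + d - 3) G = 0\<close> (\<open>weighted_slice_deriv\<close>).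
  Differentiating it \<open>j\<close> times at \<open>0\<close> shows that passing from \<open>j\<close> to \<open>j + 2\<close> multiplies the \<open>j\<close>-th
  derivative of \<open>G\<close> at \<open>0\<close> by \<open>- (n + j + 1) (n - j + d - 3)\<close>, which is also the recursion of the
  eigenvalues (\<open>funk_radon_eigenvalue_step\<close>).  The starting values are \<open>G 0 = P 0\<close> and \<open>G' 0 = P1 0\<close>.  At
  \<open>t = 0\<close> the second relation reads \<open>P2 0 = - n (n + d - 3) P 0\<close> and reduces the degree by two, down to a
  constant or a linear function (\<open>slice_integral_0\<close>); the constant is a multiple of \<open>p \<xi>\<close>, again by
  Euler's identity.
\<close>

section \<open>Double factorials and the eigenvalues\<close>

lemma double_fact_pos_step: "n \<ge> 1 \<Longrightarrow> double_fact n = of_int n * double_fact (n - 2)"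
  by (subst double_fact.simps) simp

lemma double_fact_base [simp]: "double_fact 0 = 1" "double_fact (- 1) = 1"
  by (subst double_fact.simps, simp)+

lemma double_fact_neg_step:
  assumes "odd n" "n < 0"
  shows "double_fact (n - 2) = double_fact n / of_int n"
proof -
  have "\<not> n - 2 \<ge> 1" "\<not> (n - 2 = 0 \<or> n - 2 = - 1)" "odd (n - 2)"
    using assms by presburger+
  then show ?thesis by (subst double_fact.simps) simp
qed

text \<open>
  The recursion \<open>n!! = n * (n - 2)!!\<close> holds at all odd integers and at the positive even ones.  It fails at
  \<open>n = 0\<close>, where its right-hand side is \<open>0\<close>.
\<close>

lemma double_fact_step:
  assumes "n \<ge> 1 \<or> odd n"
  shows "double_fact n = of_int n * double_fact (n - 2)"
proof (cases "n \<ge> 1")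
  case False
  with assms have "odd n" "n < 0" by presburger+
  then show ?thesis using double_fact_neg_step[of n] by simp
qed (rule double_fact_pos_step)

lemma double_fact_odd_Gamma:
  assumes "odd n"
  shows "double_fact n = 2 powr ((real_of_int n + 1) / 2) * Gamma (real_of_int n / 2 + 1) / sqrt pi"
proof -
  define P where "P k \<longleftrightarrow> double_fact (2 * k - 1) = 2 powr (real_of_int k) * Gamma (real_of_int k + 1 / 2) / sqrt pi" for k
  have G: "Gamma (real_of_int k + 3 / 2) = (real_of_int k + 1 / 2) * Gamma (real_of_int k + 1 / 2)"
     "real_of_int k + 1 / 2 \<noteq> 0" for k :: int
  proof -
    have "real_of_int (2 * k + 1) \<noteq> real_of_int 0"
      by (metis of_int_eq_iff even_plus_one_iff even_mult_iff even_numeral even_zero)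
    then show *: "real_of_int k + 1 / 2 \<noteq> 0" by simp
    have "real_of_int k + 1 / 2 \<notin> \<int>\<^sub>\<le>\<^sub>0"
    proof
      assume "real_of_int k + 1 / 2 \<in> \<int>\<^sub>\<le>\<^sub>0"
      then obtain m where "real_of_int k + 1 / 2 = of_int m" by (auto elim!: nonpos_Ints_cases)
      then have "real_of_int (2 * k + 1) = of_int (2 * m)" by simp
      then have "2 * k + 1 = 2 * m" by (simp only: of_int_eq_iff)
      then show False by presburger
    qed
    from Gamma_plus1[OF this] show "Gamma (real_of_int k + 3 / 2) = (real_of_int k + 1 / 2) * Gamma (real_of_int k + 1 / 2)"
      by (simp add: add.assoc)
  qed
  have step: "double_fact (2 * k + 1) = (2 * real_of_int k + 1) * double_fact (2 * k - 1)" for k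
    using double_fact_step[of "2 * k + 1"] by simp
  have PS: "P (k + 1) \<longleftrightarrow> P k" for k
  proof -
    have "P (k + 1) \<longleftrightarrow> (2 * real_of_int k + 1) * double_fact (2 * k - 1) = (2 * real_of_int k + 1) * (2 powr (real_of_int k) * Gamma (real_of_int k + 1 / 2) / sqrt pi)"
    proof -
      have "2 powr real_of_int (k + 1) * Gamma (real_of_int (k + 1) + 1 / 2) / sqrt pi
          = (2 * real_of_int k + 1) * (2 powr (real_of_int k) * Gamma (real_of_int k + 1 / 2) / sqrt pi)"
        using G(1)[of k] by (simp add: powr_add add.assoc algebra_simps)
      moreover have "double_fact (2 * (k + 1) - 1) = (2 * real_of_int k + 1) * double_fact (2 * k - 1)"
        using step[of k] by (simp add: algebra_simps)
      ultimately show ?thesis unfolding P_def by simp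
    qed
    also have "\<dots> \<longleftrightarrow> P k" using G(2)[of k] unfolding P_def
      by (subst mult_cancel_left) (simp add: field_simps)
    finally show ?thesis .
  qed
  have "P k" for k
  proof (induction k rule: int_induct[where k = 0])
    case base
    show ?case by (simp add: P_def Gamma_one_half_real)
  next
    case (step2 i)
    then show ?case using PS[of "i - 1"] by simp
  qed (simp add: PS)
  moreover obtain k where "n = 2 * k - 1" using assms
    by (metis oddE add_diff_cancel_right' add.commute diff_add_cancel even_add even_two_times_div_two odd_one)
  ultimately show ?thesis by (simp add: P_def diff_divide_distrib add.commute[of "1 / 2"])
qed

lemma double_fact_even_Gamma:
  "double_fact (2 * int k) = 2 ^ k * Gamma (real k + 1)"
proof (induction k)
  case (Suc k)
  have "double_fact (2 * int (Suc k)) = (2 * real k + 2) * double_fact (2 * int k)"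
    by (subst double_fact_step) auto
  moreover have "Gamma (real k + 2) = (real k + 1) * Gamma (real k + 1)"
    using Gamma_plus1[of "real k + 1"] by (simp add: nonpos_Ints_def add.commute Gamma_eq_zero_iff)
  ultimately show ?case using Suc by (simp add: algebra_simps)
qed simp

lemma double_fact_nonzero:
  assumes "n \<ge> - 1 \<or> odd n"
  shows "double_fact n \<noteq> 0"
proof -
  have pos: "double_fact (int k - 1) > 0" for k
  proof (induction k rule: less_induct)
    case (less k)
    consider "k = 0" | "k = 1" | "k \<ge> 2" by linarith
    then show ?case
    proof cases
      case 3
      then have "double_fact (int k - 1) = of_int (int k - 1) * double_fact (int (k - 2) - 1)"
        by (subst double_fact_pos_step) (auto simp: algebra_simps)
      then show ?thesis using less.IH[of "k - 2"] 3 by simp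
    qed auto
  qed
  show ?thesis
  proof (cases "n \<ge> - 1")
    case True
    then show ?thesis using pos[of "nat (n + 1)"] by simp
  next
    case False
    with assms have "odd n" by simp
    have "real_of_int n / 2 + 1 \<notin> \<int>\<^sub>\<le>\<^sub>0"
    proof
      assume "real_of_int n / 2 + 1 \<in> \<int>\<^sub>\<le>\<^sub>0"
      then obtain m where "real_of_int n / 2 + 1 = of_int m" by (auto elim!: nonpos_Ints_cases)
      then have "real_of_int n = of_int (2 * m - 2)" by simp
      then have "n = 2 * m - 2" by (simp only: of_int_eq_iff)
      then show False using \<open>odd n\<close> by presburger
    qed
    then show ?thesis using double_fact_odd_Gamma[OF \<open>odd n\<close>] by (simp add: Gamma_eq_zero_iff)
  qed
qed

text \<open>
  The recursion of the eigenvalues in the order of the derivative.  If the eigenvalue of order \<open>j\<close> is given by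
  the double factorials, then that of order \<open>j + 2\<close> is too, unless the second factor vanishes.
\<close>

lemma funk_radon_eigenvalue_step:
  "funk_radon_eigenvalue d (j + 2) n
    = - (real n + real j + 1) * (real n + real d - 3 - real j) * funk_radon_eigenvalue d j n"
proof (cases "eigenvalue_cond d j n")
  case False
  then have "\<not> eigenvalue_cond d (j + 2) n" by (auto simp: eigenvalue_cond_def)
  with False show ?thesis by (simp add: funk_radon_eigenvalue_def)
next
  case True
  define k where "k = int n - int j + int d - 3"
  have k: "real_of_int k = real n + real d - 3 - real j" by (simp add: k_def)
  have ev: "even (n + j)" using True by (simp add: eigenvalue_cond_def)
  have par: "odd k \<longleftrightarrow> even d" using ev unfolding k_def by presburger
  have c: "eigenvalue_cond d (j + 2) n \<longleftrightarrow> k \<noteq> 0"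
  proof (cases "even d")
    case True
    then show ?thesis using ev par by (auto simp: eigenvalue_cond_def)
  next
    case False
    then have "k \<ge> 0" "even k" using True par by (auto simp: eigenvalue_cond_def k_def)
    then have "k \<ge> 2 \<longleftrightarrow> k \<noteq> 0" by presburger
    then show ?thesis using ev False by (auto simp: eigenvalue_cond_def k_def)
  qed
  show ?thesis
  proof (cases "k = 0")
    case True
    then show ?thesis using c k by (simp add: funk_radon_eigenvalue_def)
  next
    case False
    have "k \<ge> 1 \<or> odd k"
      using False par True by (auto simp: eigenvalue_cond_def k_def)
    then have dk: "double_fact k = of_int k * double_fact (k - 2)" by (rule double_fact_step)
    have "k \<ge> 1 \<Longrightarrow> k - 2 \<ge> - 1" by simp
    then have nz: "double_fact (k - 2) \<noteq> 0"
      using \<open>k \<ge> 1 \<or> odd k\<close> by (intro double_fact_nonzero) auto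
    have "double_fact (int n + int (j + 2) - 1) = of_int (int n + int j + 1) * double_fact (int n + int j - 1)"
      by (subst double_fact_pos_step) (simp_all add: algebra_simps)
    moreover have "int n - int (j + 2) + int d - 3 = k - 2" by (simp add: k_def)
    moreover have "(- 1 :: real) ^ ((n + (j + 2)) div 2) = - ((- 1) ^ ((n + j) div 2))"
    proof -
      have "(n + (j + 2)) div 2 = Suc ((n + j) div 2)" by simp
      then show ?thesis by simp
    qed
    ultimately have "funk_radon_eigenvalue d (j + 2) n = sphere_area (d - 1) * - ((- 1) ^ ((n + j) div 2)) *
      ((real n + real j + 1) * double_fact (int n + int j - 1) * double_fact (int d - 3) / double_fact (k - 2))"
      using c False unfolding funk_radon_eigenvalue_def by simp
    also have "\<dots> = - (real n + real j + 1) * real_of_int k * (sphere_area (d - 1) * (- 1) ^ ((n + j) div 2) *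
      (double_fact (int n + int j - 1) * double_fact (int d - 3) / double_fact k))"
      using False nz unfolding dk by (simp add: algebra_simps add_divide_distrib diff_divide_distrib)
    also have "\<dots> = - (real n + real j + 1) * real_of_int k * funk_radon_eigenvalue d j n"
      using True unfolding funk_radon_eigenvalue_def k_def by simp
    finally show ?thesis by (simp add: k)
  qed
qed

text \<open>
  The value at \<open>0\<close> of the Legendre polynomial of degree \<open>n\<close> in dimension \<open>e + 3\<close>, normalized to be \<open>1\<close>
  at \<open>1\<close>, given by the recursion that \<open>slice_integral_0\<close> produces.
\<close>

fun legendre_at_0 :: "nat \<Rightarrow> nat \<Rightarrow> real" where
  "legendre_at_0 e 0 = 1"
| "legendre_at_0 e (Suc 0) = 0"
| "legendre_at_0 e (Suc (Suc n)) = - (real n + 1) / (real n + 2 + real e) * legendre_at_0 e n"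

lemma legendre_at_0_odd: "odd n \<Longrightarrow> legendre_at_0 e n = 0"
  by (induction e n rule: legendre_at_0.induct) auto

lemma legendre_at_0_double_fact:
  assumes "even n"
  shows "legendre_at_0 e n = (- 1) ^ (n div 2) * double_fact (int n - 1) * double_fact (int e) / double_fact (int n + int e)"
  using assms
proof (induction e n rule: legendre_at_0.induct)
  case (1 e)
  then show ?case using double_fact_nonzero[of "int e"] by simp
next
  case (3 e n)
  have 1: "double_fact (int (Suc (Suc n)) - 1) = (real n + 1) * double_fact (int n - 1)"
    by (subst double_fact_pos_step) simp_all
  have 2: "double_fact (int (Suc (Suc n)) + int e) = (real n + 2 + real e) * double_fact (int n + int e)"
    by (subst double_fact_pos_step) (simp_all add: algebra_simps)
  have 3: "legendre_at_0 e (Suc (Suc n)) = - (real n + 1) / (real n + 2 + real e) *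
    ((- 1) ^ (n div 2) * double_fact (int n - 1) * double_fact (int e) / double_fact (int n + int e))"
    using 3 by simp
  have 4: "- x / y * (s * u * v / w) = - s * (x * u) * v / (y * w)" for x y s u v w :: real by simp
  have 5: "Suc (Suc n) div 2 = Suc (n div 2)" by simp
  show ?case unfolding 1 2 3 4 5 by simp
qed simp

lemma funk_radon_eigenvalue_0:
  assumes "d \<ge> 3"
  shows "funk_radon_eigenvalue d 0 n = sphere_area (d - 1) * legendre_at_0 (d - 3) n"
proof (cases "even n")
  case True
  then show ?thesis
    using assms
      by (simp add: legendre_at_0_double_fact funk_radon_eigenvalue_def eigenvalue_cond_def of_nat_diff add_diff_eq)
qed (simp add: funk_radon_eigenvalue_def eigenvalue_cond_def legendre_at_0_odd)

lemma funk_radon_eigenvalue_1: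
  assumes "d \<ge> 3"
  shows "funk_radon_eigenvalue d 1 n = - (sphere_area (d - 1) * (real n * legendre_at_0 (d - 3) (n - 1)))"
proof (cases "odd n")
  case True
  then obtain k where n: "n = Suc k" "even k" by (cases n) auto
  have "double_fact (int n) = real n * double_fact (int k - 1)"
    using n by (subst double_fact_pos_step) (simp_all add: add.commute)
  moreover have "(n + 1) div 2 = Suc (k div 2)" using n by simp
  moreover have "int k + int (d - 3) = int n - int 1 + int d - 3" using n assms by simp
  ultimately show ?thesis
    using assms n True
      by (simp add: legendre_at_0_double_fact funk_radon_eigenvalue_def eigenvalue_cond_def of_nat_diff add_diff_eq mult_ac)
next
  case False
  then have "legendre_at_0 (d - 3) (n - 1) = 0 \<or> n = 0"
    by (cases n) (auto intro: legendre_at_0_odd)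
  then show ?thesis using False by (auto simp: funk_radon_eigenvalue_def eigenvalue_cond_def)
qed

lemma funk_radon_eigenvalue_Gamma:
  assumes d: "d \<ge> 3" and c: "eigenvalue_cond d j n"
  shows "funk_radon_eigenvalue d j n =
              pi powr ((real d - 2) / 2) * (- 1) ^ ((n + j) div 2) * 2 ^ (j + 1) *
              (Gamma ((real n + real j + 1) / 2) /
               Gamma ((real n - real j + real d - 1) / 2))"
proof -
  define k where "k = int n - int j + int d - 3"
  have ev: "even (n + j)" using c by (simp add: eigenvalue_cond_def)
  define G where "G = Gamma ((real n - real j + real d - 1) / 2)"
  define H where "H = Gamma ((real d - 1) / 2)"
  have H: "H > 0" unfolding H_def using d by (intro Gamma_real_pos) simp
  have 1: "double_fact (int n + int j - 1) = 2 powr ((real n + real j) / 2) * Gamma ((real n + real j + 1) / 2) / sqrt pi"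
  proof -
    have "odd (int n + int j - 1)" using ev by presburger
    from double_fact_odd_Gamma[OF this] show ?thesis by (simp add: add_divide_distrib diff_divide_distrib add_ac)
  qed
  have 2: "double_fact (int d - 3) / double_fact k = 2 powr ((real j - real n) / 2) * (H / G)"
  proof (cases "even d")
    case True
    then have o: "odd (int d - 3)" "odd k" using ev unfolding k_def by presburger+
    have kr: "(real_of_int k + 1) / 2 = (real n - real j + real d - 2) / 2"
      "real_of_int k / 2 + 1 = (real n - real j + real d - 1) / 2"
      unfolding k_def by (simp_all add: field_simps)
    have a: "double_fact (int d - 3) = 2 powr ((real d - 2) / 2) * H / sqrt pi"
      using double_fact_odd_Gamma[OF o(1)] by (simp add: H_def diff_divide_distrib)
    have b: "double_fact k = 2 powr ((real n - real j + real d - 2) / 2) * G / sqrt pi"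
      using double_fact_odd_Gamma[OF o(2)] unfolding kr G_def .
    have "2 powr ((real d - 2) / 2) = 2 powr ((real j - real n) / 2) * 2 powr ((real n - real j + real d - 2) / 2)"
      by (simp add: powr_add[symmetric] add_divide_distrib diff_divide_distrib)
    then show ?thesis unfolding a b by simp
  next
    case False
    then have "k \<ge> 0" "even k" using ev c unfolding k_def eigenvalue_cond_def by auto
    define i where "i = nat (k div 2)"
    have i: "k = 2 * int i" using \<open>k \<ge> 0\<close> \<open>even k\<close> by (simp add: i_def)
    define l where "l = nat ((int d - 3) div 2)"
    have "even (int d - 3)" using False by presburger
    then have l: "int d - 3 = 2 * int l" using d by (simp add: l_def)
    have rl: "real l = (real d - 3) / 2" using arg_cong[OF l, of real_of_int] by simp
    have ri: "real i = (real n - real j + real d - 3) / 2" using arg_cong[OF i, of real_of_int] unfolding k_def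
      by simp
    have a: "double_fact (int d - 3) = 2 ^ l * H"
      unfolding l double_fact_even_Gamma H_def rl by (simp add: diff_divide_distrib)
    have b: "double_fact k = 2 ^ i * G"
    proof -
      have ri1: "real i + 1 = (real n - real j + real d - 1) / 2" unfolding ri by (simp add: field_simps)
      show ?thesis unfolding i double_fact_even_Gamma G_def by (simp only: ri1)
    qed
    have "(2::real) ^ l = 2 powr ((real j - real n) / 2) * 2 ^ i"
      unfolding powr_realpow[of 2, symmetric, simplified] rl ri
      by (simp add: powr_add[symmetric] add_divide_distrib diff_divide_distrib)
    then show ?thesis unfolding a b by simp
  qed
  have "double_fact (int n + int j - 1) * (double_fact (int d - 3) / double_fact k)
     = 2 ^ j * Gamma ((real n + real j + 1) / 2) * (H / G) / sqrt pi"
  proof -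
    have "(2::real) ^ j = 2 powr ((real n + real j) / 2) * 2 powr ((real j - real n) / 2)"
      unfolding powr_realpow[of 2, symmetric, simplified]
      by (simp add: powr_add[symmetric] add_divide_distrib diff_divide_distrib)
    then show ?thesis unfolding 1 2 by (simp add: mult_ac)
  qed
  then have "funk_radon_eigenvalue d j n = sphere_area (d - 1) * (- 1) ^ ((n + j) div 2) *
     (2 ^ j * Gamma ((real n + real j + 1) / 2) * (H / G) / sqrt pi)"
    using c by (simp add: funk_radon_eigenvalue_def k_def)
  also have "sphere_area (d - 1) = 2 * (pi powr ((real d - 2) / 2) * sqrt pi) / H"
  proof -
    have "pi powr ((real d - 1) / 2) = pi powr ((real d - 2) / 2) * sqrt pi"
      by (simp add: powr_half_sqrt[symmetric] powr_add[symmetric] diff_divide_distrib)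
    then show ?thesis using d by (simp add: sphere_area_def H_def of_nat_diff)
  qed
  finally show ?thesis using H by (simp add: G_def)
qed

section \<open>Derivatives of complex polynomials\<close>

lemma polynomial_function_cmult:
  fixes f g :: "'a::euclidean_space \<Rightarrow> complex"
  assumes "polynomial_function f" "polynomial_function g"
  shows "polynomial_function (\<lambda>x. f x * g x)"
proof -
  have *: "real_polynomial_function (\<lambda>x. Re (h x)) \<and> real_polynomial_function (\<lambda>x. Im (h x))"
    if "polynomial_function h" for h :: "'a \<Rightarrow> complex"
    using that bounded_linear_Re bounded_linear_Im unfolding polynomial_function_def o_def by blast
  show ?thesis
    unfolding polynomial_function_iff_Basis_inner
    using *[OF assms(1)] *[OF assms(2)]
    by (auto simp: Basis_complex_def inner_complex_def)
qed

lemma polynomial_function_of_real: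
  fixes f :: "'a::euclidean_space \<Rightarrow> real"
  assumes "real_polynomial_function f"
  shows "polynomial_function (\<lambda>x. complex_of_real (f x))"
  using polynomial_function_mult[OF assms[unfolded real_polynomial_function_eq] polynomial_function_const[of "1 :: complex"]]
  by (simp add: scaleR_conv_of_real)

text \<open>
  Any complex polynomial on a real vector space is \<open>f + \<i> g\<close> with real polynomials \<open>f\<close> and \<open>g\<close>, and
  so it is built from real linear forms and complex constants by sums and products.
\<close>

lemma complex_polynomial_induct [consumes 1, case_names linear const add mult]:
  fixes p :: "'a::euclidean_space \<Rightarrow> complex"
  assumes p: "polynomial_function p"
    and linear: "\<And>f. bounded_linear f \<Longrightarrow> P (\<lambda>x. complex_of_real (f x))"
    and const: "\<And>c. P (\<lambda>x. c)"
    and add: "\<And>f g. polynomial_function f \<Longrightarrow> polynomial_function g \<Longrightarrow> P f \<Longrightarrow> P g \<Longrightarrow> P (\<lambda>x. f x + g x)"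
    and mult: "\<And>f g. polynomial_function f \<Longrightarrow> polynomial_function g \<Longrightarrow> P f \<Longrightarrow> P g \<Longrightarrow> P (\<lambda>x. f x * g x)"
  shows "P p"
proof -
  have real: "P (\<lambda>x. complex_of_real (f x))" if "real_polynomial_function f" for f :: "'a \<Rightarrow> real"
    using that
  proof induction
    case (add f g)
    with assms(4)[OF polynomial_function_of_real polynomial_function_of_real] show ?case by simp
  next
    case (mult f g)
    with assms(5)[OF polynomial_function_of_real polynomial_function_of_real] show ?case by simp
  qed (auto intro: linear const)
  have poly: "real_polynomial_function (\<lambda>x. Re (p x))" "real_polynomial_function (\<lambda>x. Im (p x))"
    using p bounded_linear_Re bounded_linear_Im unfolding polynomial_function_def o_def by blast+
  then have "P (\<lambda>x. complex_of_real (Re (p x)) + \<i> * complex_of_real (Im (p x)))"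
    by (intro add mult const real polynomial_function_of_real polynomial_function_cmult polynomial_function_const)
  then show ?thesis by (simp flip: complex_eq)
qed

lemma polynomial_has_derivative_ex:
  fixes p :: "'a::euclidean_space \<Rightarrow> complex"
  assumes "polynomial_function p"
  shows "\<exists>p'. (\<forall>x. (p has_derivative p' x) (at x)) \<and> (\<forall>v. polynomial_function (\<lambda>x. p' x v))"
  using assms
proof (induction rule: complex_polynomial_induct)
  case (linear f)
  have "((\<lambda>x. complex_of_real (f x)) has_derivative (\<lambda>v. complex_of_real (f v))) (at x)" for x
    by (intro derivative_intros bounded_linear_imp_has_derivative linear)
  then show ?case by (intro exI[of _ "\<lambda>x v. complex_of_real (f v)"]) auto
next
  case (const c)
  show ?case by (rule exI[of _ "\<lambda>x v. 0"]) auto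
next
  case (add f g)
  then obtain f' g' where "\<forall>x. (f has_derivative f' x) (at x)" "\<forall>v. polynomial_function (\<lambda>x. f' x v)"
    "\<forall>x. (g has_derivative g' x) (at x)" "\<forall>v. polynomial_function (\<lambda>x. g' x v)" by blast
  then show ?case
    by (intro exI[of _ "\<lambda>x v. f' x v + g' x v"]) (auto intro!: derivative_intros)
next
  case (mult f g)
  then obtain f' g' where *: "\<forall>x. (f has_derivative f' x) (at x)" "\<forall>v. polynomial_function (\<lambda>x. f' x v)"
    "\<forall>x. (g has_derivative g' x) (at x)" "\<forall>v. polynomial_function (\<lambda>x. g' x v)" by blast
  with mult.hyps show ?case
    by (intro exI[of _ "\<lambda>x v. f x * g' x v + f' x v * g x"]) (auto intro!: derivative_intros polynomial_function_cmult)
qed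


text \<open>
  The directional derivative is the Frechet derivative evaluated at a vector.  In particular it is linear in
  the direction.
\<close>

lemma directional_derivative_eqI:
  fixes p :: "'a::euclidean_space \<Rightarrow> complex"
  assumes "(p has_derivative p') (at x)"
  shows "directional_derivative v p x = p' v"
proof -
  have "((\<lambda>s. p (x + s *\<^sub>R v)) has_derivative (\<lambda>s. p' (s *\<^sub>R v))) (at 0)"
    by (rule has_derivative_compose[where f = "\<lambda>s. x + s *\<^sub>R v" and g = p])
       (use assms in \<open>auto intro!: derivative_eq_intros\<close>)
  moreover have "(\<lambda>s. p' (s *\<^sub>R v)) = (\<lambda>s. s *\<^sub>R p' v)"
    using assms by (auto simp: fun_eq_iff linear_scale has_derivative_linear)
  ultimately show ?thesis
    unfolding directional_derivative_def
    by (intro vector_derivative_at) (simp add: has_vector_derivative_def)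
qed

lemma polynomial_has_derivative:
  fixes p :: "'a::euclidean_space \<Rightarrow> complex"
  assumes "polynomial_function p"
  shows "(p has_derivative (\<lambda>v. directional_derivative v p x)) (at x)"
proof -
  obtain p' where p': "\<And>x. (p has_derivative p' x) (at x)"
    using polynomial_has_derivative_ex[OF assms] by blast
  then have "(\<lambda>v. directional_derivative v p x) = p' x"
    by (intro ext directional_derivative_eqI)
  then show ?thesis using p'[of x] by simp
qed

lemma polynomial_directional_derivative:
  fixes p :: "'a::euclidean_space \<Rightarrow> complex"
  assumes "polynomial_function p"
  shows "polynomial_function (directional_derivative v p)"
proof -
  obtain p' where p': "\<And>x. (p has_derivative p' x) (at x)" "\<And>v. polynomial_function (\<lambda>x. p' x v)"
    using polynomial_has_derivative_ex[OF assms] by blast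
  from p'(1) have "directional_derivative v p = (\<lambda>x. p' x v)"
    by (intro ext directional_derivative_eqI)
  then show ?thesis using p'(2)[of v] by simp
qed

lemma linear_directional_derivative:
  fixes p :: "'a::euclidean_space \<Rightarrow> complex"
  assumes "polynomial_function p"
  shows "linear (\<lambda>v. directional_derivative v p x)"
  using polynomial_has_derivative[OF assms] by (rule has_derivative_linear)

lemma directional_derivative_add:
  fixes p q :: "'a::euclidean_space \<Rightarrow> complex"
  assumes "polynomial_function p" "polynomial_function q"
  shows "directional_derivative v (\<lambda>x. p x + q x) x = directional_derivative v p x + directional_derivative v q x"
  by (rule directional_derivative_eqI[where p' = "\<lambda>v. directional_derivative v p x + directional_derivative v q x"])
    (intro has_derivative_add polynomial_has_derivative assms)

lemma directional_derivative_mult: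
  fixes p q :: "'a::euclidean_space \<Rightarrow> complex"
  assumes "polynomial_function p" "polynomial_function q"
  shows "directional_derivative v (\<lambda>x. p x * q x) x
    = p x * directional_derivative v q x + directional_derivative v p x * q x"
  by (rule directional_derivative_eqI[where p' = "\<lambda>v. p x * directional_derivative v q x + directional_derivative v p x * q x"])
    (intro has_derivative_mult polynomial_has_derivative assms)

lemma directional_derivative_const [simp]:
  fixes v :: "'a::euclidean_space"
  shows "directional_derivative v (\<lambda>x. c) = (\<lambda>x. 0)"
  by (rule ext, rule directional_derivative_eqI[where p' = "\<lambda>v. 0"]) auto

lemma directional_derivative_linear:
  assumes "bounded_linear (f :: 'a::euclidean_space \<Rightarrow> real)"
  shows "directional_derivative v (\<lambda>x. complex_of_real (f x)) = (\<lambda>x. complex_of_real (f v))"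
proof
  fix x
  have "((\<lambda>x. complex_of_real (f x)) has_derivative (\<lambda>v. complex_of_real (f v))) (at x)"
    by (intro derivative_intros bounded_linear_imp_has_derivative assms)
  then show "directional_derivative v (\<lambda>x. complex_of_real (f x)) x = complex_of_real (f v)"
    by (rule directional_derivative_eqI)
qed

lemma directional_derivative_commute:
  fixes p :: "'a::euclidean_space \<Rightarrow> complex"
  assumes "polynomial_function p"
  shows "directional_derivative u (directional_derivative v p) = directional_derivative v (directional_derivative u p)"
  using assms
proof (induction rule: complex_polynomial_induct)
  case (linear f)
  then show ?case by (simp add: directional_derivative_linear)
next
  case (add f g)
  have *: "directional_derivative w (\<lambda>x. f x + g x) = (\<lambda>x. directional_derivative w f x + directional_derivative w g x)" for w
    using add.hyps by (auto simp: directional_derivative_add)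
  show ?case using add by (auto simp: * directional_derivative_add polynomial_directional_derivative)
next
  case (mult f g)
  have *: "directional_derivative w (\<lambda>x. f x * g x)
      = (\<lambda>x. f x * directional_derivative w g x + directional_derivative w f x * g x)" for w
    using mult.hyps by (auto simp: directional_derivative_mult)
  show ?case using mult
    by (auto simp: * directional_derivative_add directional_derivative_mult polynomial_directional_derivative
          polynomial_function_cmult)
qed simp

text \<open>
  Differentiating \<open>p\<close> along a linear vector field \<open>A\<close>.  In the first term of the second conclusion the inner
  direction \<open>A x\<close> is frozen at the point \<open>x\<close> before the outer derivative is taken.
\<close>

lemma directional_derivative_along:
  fixes p :: "'a::euclidean_space \<Rightarrow> complex"
  assumes p: "polynomial_function p" and A: "linear A"
  shows "polynomial_function (\<lambda>x. directional_derivative (A x) p x)"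
    and "directional_derivative u (\<lambda>x. directional_derivative (A x) p x) x
      = directional_derivative u (directional_derivative (A x) p) x + directional_derivative (A u) p x"
proof -
  have exp: "directional_derivative w q x = (\<Sum>b\<in>Basis. of_real (w \<bullet> b) * directional_derivative b q x)"
    if "polynomial_function q" for q :: "'a \<Rightarrow> complex" and w x
  proof -
    interpret linear "\<lambda>v. directional_derivative v q x" by (rule linear_directional_derivative[OF that])
    have "directional_derivative w q x = directional_derivative (\<Sum>b\<in>Basis. (w \<bullet> b) *\<^sub>R b) q x"
      by (simp add: euclidean_representation)
    also have "\<dots> = (\<Sum>b\<in>Basis. of_real (w \<bullet> b) * directional_derivative b q x)"
      by (simp add: sum scaleR scaleR_conv_of_real)
    finally show ?thesis .
  qed
  have eq: "(\<lambda>x. directional_derivative (A x) p x)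
      = (\<lambda>x. \<Sum>b\<in>Basis. of_real (A x \<bullet> b) * directional_derivative b p x)"
    by (rule ext, rule exp[OF p])
  have bl: "bounded_linear (\<lambda>x. A x \<bullet> b)" for b
    using A by (intro bounded_linear_inner_left_comp) (simp add: linear_conv_bounded_linear)
  show "polynomial_function (\<lambda>x. directional_derivative (A x) p x)"
    unfolding eq
    by (intro polynomial_function_sum polynomial_function_cmult polynomial_function_of_real real_polynomial_function.intros(1)
         bl polynomial_directional_derivative p finite_Basis)
  have "((\<lambda>x. \<Sum>b\<in>Basis. of_real (A x \<bullet> b) * directional_derivative b p x) has_derivative
     (\<lambda>u. \<Sum>b\<in>Basis. of_real (A x \<bullet> b) * directional_derivative u (directional_derivative b p) x
         + of_real (A u \<bullet> b) * directional_derivative b p x)) (at x)"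
    by (intro derivative_intros bounded_linear_imp_has_derivative[OF bl] polynomial_has_derivative
         polynomial_directional_derivative p)
  then have "directional_derivative u (\<lambda>x. directional_derivative (A x) p x) x
    = (\<Sum>b\<in>Basis. of_real (A x \<bullet> b) * directional_derivative u (directional_derivative b p) x)
         + (\<Sum>b\<in>Basis. of_real (A u \<bullet> b) * directional_derivative b p x)"
    unfolding eq by (subst directional_derivative_eqI, assumption) (simp add: sum.distrib)
  also have "(\<Sum>b\<in>Basis. of_real (A x \<bullet> b) * directional_derivative u (directional_derivative b p) x)
     = (\<Sum>b\<in>Basis. of_real (A x \<bullet> b) * directional_derivative b (directional_derivative u p) x)"
    by (simp add: directional_derivative_commute[OF p, of u])
  also have "\<dots> = directional_derivative (A x) (directional_derivative u p) x"
    by (rule exp[symmetric]) (rule polynomial_directional_derivative[OF p])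
  also have "\<dots> = directional_derivative u (directional_derivative (A x) p) x"
    by (simp add: directional_derivative_commute[OF p, of u])
  also have "(\<Sum>b\<in>Basis. of_real (A u \<bullet> b) * directional_derivative b p x) = directional_derivative (A u) p x"
    by (rule exp[OF p, symmetric])
  finally show "directional_derivative u (\<lambda>x. directional_derivative (A x) p x) x
      = directional_derivative u (directional_derivative (A x) p) x + directional_derivative (A u) p x" .
qed

lemma directional_derivative_cmult:
  fixes F :: "'a::euclidean_space \<Rightarrow> complex"
  assumes "polynomial_function F"
  shows "directional_derivative v (\<lambda>x. c * F x) x = c * directional_derivative v F x"
  using directional_derivative_mult[OF polynomial_function_const assms, of v c x] by simp

lemma directional_derivative_sum:
  fixes F :: "'i \<Rightarrow> 'a::euclidean_space \<Rightarrow> complex"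
  assumes "finite I" "\<And>i. i \<in> I \<Longrightarrow> polynomial_function (F i)"
  shows "directional_derivative v (\<lambda>x. \<Sum>i\<in>I. F i x) x = (\<Sum>i\<in>I. directional_derivative v (F i) x)"
  by (rule directional_derivative_eqI[where p' = "\<lambda>v. \<Sum>i\<in>I. directional_derivative v (F i) x"])
    (intro has_derivative_sum polynomial_has_derivative assms)

lemma polynomial_chain_rule:
  fixes F :: "'a::euclidean_space \<Rightarrow> complex" and \<gamma> :: "real \<Rightarrow> 'a"
  assumes F: "polynomial_function F" and \<gamma>: "(\<gamma> has_vector_derivative \<gamma>') (at t)"
  shows "((\<lambda>t. F (\<gamma> t)) has_vector_derivative directional_derivative \<gamma>' F (\<gamma> t)) (at t)"
proof -
  interpret D: linear "\<lambda>v. directional_derivative v F (\<gamma> t)"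
    by (rule linear_directional_derivative[OF F])
  have "((\<lambda>t. F (\<gamma> t)) has_derivative (\<lambda>s. directional_derivative (s *\<^sub>R \<gamma>') F (\<gamma> t))) (at t)"
    by (rule has_derivative_compose[OF \<gamma>[unfolded has_vector_derivative_def] polynomial_has_derivative[OF F]])
  then show ?thesis by (simp add: has_vector_derivative_def D.scaleR)
qed

lemma directional_derivative_bound:
  fixes p :: "'a::euclidean_space \<Rightarrow> complex"
  assumes p: "polynomial_function p"
  obtains K where "K \<ge> 0" "\<And>x v. norm x \<le> R \<Longrightarrow> norm (directional_derivative v p x) \<le> K * norm v"
proof -
  have "\<exists>k. \<forall>x\<in>cball 0 R. norm (directional_derivative b p x) \<le> k" for b
  proof -
    have "continuous_on (cball 0 R) (directional_derivative b p)"
      by (intro continuous_on_polymonial_function polynomial_directional_derivative p)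
    then have "bounded (directional_derivative b p ` cball 0 R)"
      by (intro compact_imp_bounded compact_continuous_image) auto
    then show ?thesis by (auto simp: bounded_iff)
  qed
  then obtain k where "\<And>b. \<forall>x\<in>cball 0 R. norm (directional_derivative b p x) \<le> k b"
    by metis
  then have k: "\<And>b x. norm x \<le> R \<Longrightarrow> norm (directional_derivative b p x) \<le> k b" by simp
  show ?thesis
  proof (rule that[of "\<Sum>b\<in>Basis. \<bar>k b\<bar>"])
    fix x v :: 'a assume x: "norm x \<le> R"
    interpret D: linear "\<lambda>v. directional_derivative v p x" by (rule linear_directional_derivative[OF p])
    have "directional_derivative v p x = (\<Sum>b\<in>Basis. (v \<bullet> b) *\<^sub>R directional_derivative b p x)"
      by (subst (1) euclidean_representation[of v, symmetric]) (simp only: D.sum D.scaleR)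
    also have "norm \<dots> \<le> (\<Sum>b\<in>Basis. norm ((v \<bullet> b) *\<^sub>R directional_derivative b p x))"
      by (rule norm_sum)
    also have "\<dots> \<le> (\<Sum>b\<in>Basis. norm v * \<bar>k b\<bar>)"
    proof (rule sum_mono)
      fix b :: 'a assume "b \<in> Basis"
      then have "\<bar>v \<bullet> b\<bar> \<le> norm v" by (rule Basis_le_norm)
      moreover have "norm (directional_derivative b p x) \<le> \<bar>k b\<bar>" using k[OF x, of b] by linarith
      ultimately show "norm ((v \<bullet> b) *\<^sub>R directional_derivative b p x) \<le> norm v * \<bar>k b\<bar>"
        by (simp add: mult_mono)
    qed
    also have "\<dots> = (\<Sum>b\<in>Basis. \<bar>k b\<bar>) * norm v"
      by (simp add: sum_distrib_left mult.commute)
    finally show "norm (directional_derivative v p x) \<le> (\<Sum>b\<in>Basis. \<bar>k b\<bar>) * norm v" .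
  qed (simp add: sum_nonneg)
qed

section \<open>Surface measures of spheres and sub-spheres\<close>

lemma nn_integral_lborel_translate:
  fixes a :: "'a::euclidean_space"
  assumes [measurable]: "f \<in> borel_measurable borel"
  shows "(\<integral>\<^sup>+x. f (a + x) \<partial>lborel) = (\<integral>\<^sup>+x. f x \<partial>lborel)"
  by (subst (2) lborel_distr_plus[of a, symmetric]) (simp add: nn_integral_distr)

lemma orthogonal_transformation_imp_borel:
  fixes T :: "'a::euclidean_space \<Rightarrow> 'a"
  shows "orthogonal_transformation T \<Longrightarrow> T \<in> borel_measurable borel"
  by (intro borel_measurable_continuous_onI linear_continuous_on)
     (simp add: orthogonal_transformation_linear linear_linear flip: linear_conv_bounded_linear)

text \<open>
  Lebesgue measure on an abstract Euclidean space is invariant under orthogonal transformations \<open>T\<close>.  The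
  image of Lebesgue measure under \<open>T\<close> is translation invariant; integrating \<open>indicator A (x + T y) *
  indicator B x\<close> in both orders, with \<open>B\<close> the unit ball, shows that it agrees with Lebesgue measure up to
  a factor, which is \<open>1\<close> because \<open>T\<close> preserves \<open>B\<close>.
\<close>

lemma emeasure_lborel_orthogonal_vimage:
  fixes T :: "'a::euclidean_space \<Rightarrow> 'a"
  assumes T: "orthogonal_transformation T" and A: "A \<in> sets borel"
  shows "emeasure lborel (T -` A) = emeasure lborel A"
proof -
  note [measurable] = A orthogonal_transformation_imp_borel[OF T]
  define S where "S = inv T"
  have S: "orthogonal_transformation S"
    unfolding S_def using T by (rule orthogonal_transformation_inv)
  have TS: "T (S x) = x" for x
    unfolding S_def using orthogonal_transformation_surj[OF T] by (simp add: surj_f_inv_f)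
  have lin: "linear T" "linear S" using S T by (auto simp: orthogonal_transformation_linear)
  let ?B = "cball (0::'a) 1"
  have [measurable]: "?B \<in> sets borel" by simp
  define v where "v = emeasure lborel ?B"
  have v: "v \<noteq> 0" "v \<noteq> \<infinity>"
    unfolding v_def using unit_ball_vol_pos[of "real DIM('a)"]
      by (auto simp: emeasure_cball simp del: unit_ball_vol_pos)
  have "emeasure lborel (T -` A) * v = (\<integral>\<^sup>+x. emeasure lborel (T -` A) * indicator ?B x \<partial>lborel)"
    unfolding v_def by (subst nn_integral_cmult_indicator) auto
  also have "\<dots> = (\<integral>\<^sup>+x. (\<integral>\<^sup>+y. indicator A (x + T y) * indicator ?B x \<partial>lborel) \<partial>lborel)"
  proof (rule nn_integral_cong)
    fix x :: 'a
    have "(\<integral>\<^sup>+y. indicator A (x + T y) \<partial>lborel) = (\<integral>\<^sup>+y. indicator A (T (S x + y)) \<partial>lborel)"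
      by (simp add: linear_add[OF lin(1)] TS)
    also have "\<dots> = (\<integral>\<^sup>+y. indicator A (T y) \<partial>lborel)"
      by (rule nn_integral_lborel_translate) measurable
    also have "\<dots> = (\<integral>\<^sup>+y. indicator (T -` A) y \<partial>lborel)"
      by (simp add: indicator_def)
    also have "\<dots> = emeasure lborel (T -` A)"
      using measurable_sets[OF orthogonal_transformation_imp_borel[OF T] A] by (intro nn_integral_indicator) simp
    finally show "emeasure lborel (T -` A) * indicator ?B x
        = (\<integral>\<^sup>+y. indicator A (x + T y) * indicator ?B x \<partial>lborel)"
      by (subst nn_integral_multc) auto
  qed
  also have "\<dots> = (\<integral>\<^sup>+y. (\<integral>\<^sup>+x. indicator A (x + T y) * indicator ?B x \<partial>lborel) \<partial>lborel)"
    by (rule lborel_pair.Fubini'[symmetric]) measurable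
  also have "\<dots> = (\<integral>\<^sup>+y. (\<integral>\<^sup>+x. indicator A x * indicator ?B (x - T y) \<partial>lborel) \<partial>lborel)"
  proof (rule nn_integral_cong)
    fix y :: 'a
    have "(\<integral>\<^sup>+x. indicator A x * indicator ?B (x - T y) \<partial>lborel)
      = (\<integral>\<^sup>+x. indicator A (T y + x) * indicator ?B (T y + x - T y) \<partial>lborel :: ennreal)"
      by (rule nn_integral_lborel_translate[symmetric]) measurable
    then show "(\<integral>\<^sup>+x. indicator A (x + T y) * indicator ?B x \<partial>lborel)
        = (\<integral>\<^sup>+x. indicator A x * indicator ?B (x - T y) \<partial>lborel :: ennreal)"
      by (simp add: add.commute)
  qed
  also have "\<dots> = (\<integral>\<^sup>+x. (\<integral>\<^sup>+y. indicator A x * indicator ?B (x - T y) \<partial>lborel) \<partial>lborel)"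
    by (rule lborel_pair.Fubini') measurable
  also have "\<dots> = (\<integral>\<^sup>+x. indicator A x * v \<partial>lborel)"
  proof (rule nn_integral_cong)
    fix x :: 'a
    have "(\<integral>\<^sup>+y. indicator ?B (x - T y) \<partial>lborel) = (\<integral>\<^sup>+y. indicator (cball (S x) 1) y \<partial>lborel :: ennreal)"
    proof (rule nn_integral_cong)
      fix y
      have "norm (x - T y) = norm (T (S x - y))"
        by (simp add: linear_diff[OF lin(1)] TS)
      also have "\<dots> = norm (S x - y)" using T by (simp add: orthogonal_transformation_norm)
      finally show "indicator ?B (x - T y) = (indicator (cball (S x) 1) y :: ennreal)"
        by (simp add: indicator_def dist_norm norm_minus_commute)
    qed
    also have "\<dots> = v" unfolding v_def by (simp add: emeasure_cball)
    finally show "(\<integral>\<^sup>+y. indicator A x * indicator ?B (x - T y) \<partial>lborel) = indicator A x * v"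
      by (subst nn_integral_cmult) auto
  qed
  also have "\<dots> = emeasure lborel A * v"
    by (simp add: nn_integral_multc)
  finally show ?thesis using v by (simp add: mult.commute[of _ v] ennreal_mult_cancel_left)
qed

text \<open>
  The reflection in the hyperplane orthogonal to \<open>a - b\<close> takes \<open>a\<close> to \<open>b\<close>.
\<close>

lemma orthogonal_transformation_takes_to:
  fixes a b :: "'a::euclidean_space"
  assumes "norm a = norm b"
  obtains H where "orthogonal_transformation H" "H a = b"
proof (cases "a = b")
  case True
  then show ?thesis by (intro that[of "\<lambda>x. x"]) (simp_all add: orthogonal_transformation_id)
next
  case False
  define u where "u = a - b"
  have u: "u \<bullet> u \<noteq> 0" using False by (simp add: u_def)
  define H where "H x = x - (2 * (u \<bullet> x) / (u \<bullet> u)) *\<^sub>R u" for x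
  have ab: "a \<bullet> a = b \<bullet> b" using assms by (simp add: norm_eq_sqrt_inner)
  have uu: "u \<bullet> u = 2 * (u \<bullet> a)"
    unfolding u_def using ab by (simp add: inner_diff_left inner_diff_right inner_commute[of b a])
  show ?thesis
  proof (rule that[of H])
    show "orthogonal_transformation H"
      unfolding orthogonal_transformation_def
    proof
      show "linear H" unfolding H_def
        by (intro linearI) (simp_all add: inner_add_right algebra_simps add_divide_distrib)
      show "\<forall>v w. H v \<bullet> H w = v \<bullet> w"
      proof (intro allI)
        fix v w
        show "H v \<bullet> H w = v \<bullet> w"
          unfolding H_def using u
          by (simp add: inner_diff_left inner_diff_right inner_commute[of v u] field_simps)
      qed
    qed
    have "H a = a - u" using u unfolding H_def uu[symmetric] by simp
    then show "H a = b" by (simp add: u_def)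
  qed
qed

text \<open>
  Orthogonal projection onto the hyperplane orthogonal to \<open>\<xi>\<close>, for a unit vector \<open>\<xi>\<close>.
\<close>

definition hyperplane_proj :: "'a::euclidean_space \<Rightarrow> 'a \<Rightarrow> 'a" where
  "hyperplane_proj \<xi> x = x - (\<xi> \<bullet> x) *\<^sub>R \<xi>"

lemma closest_point_hyperplane:
  fixes \<xi> :: "'a::euclidean_space"
  assumes "norm \<xi> = 1"
  shows "closest_point {y. \<xi> \<bullet> y = 0} x = hyperplane_proj \<xi> x"
proof (rule closest_point_unique[symmetric])
  have \<xi>: "\<xi> \<bullet> \<xi> = 1" using assms by (simp add: norm_eq_1)
  show "hyperplane_proj \<xi> x \<in> {y. \<xi> \<bullet> y = 0}"
    using \<xi> by (simp add: hyperplane_proj_def inner_simps)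
  show "\<forall>z\<in>{y. \<xi> \<bullet> y = 0}. dist x (hyperplane_proj \<xi> x) \<le> dist x z"
  proof
    fix z assume "z \<in> {y. \<xi> \<bullet> y = 0}"
    then have "\<bar>\<xi> \<bullet> x\<bar> = \<bar>\<xi> \<bullet> (x - z)\<bar>" by (simp add: inner_simps)
    also have "\<dots> \<le> norm \<xi> * norm (x - z)" by (rule Cauchy_Schwarz_ineq2)
    finally show "dist x (hyperplane_proj \<xi> x) \<le> dist x z"
      using assms by (simp add: dist_norm hyperplane_proj_def)
  qed
qed (auto intro: convex_hyperplane closed_hyperplane)

lemma measurable_hyperplane_proj [measurable]: "hyperplane_proj \<xi> \<in> borel_measurable borel"
  unfolding hyperplane_proj_def[abs_def] by measurable

text \<open>
  Up to a factor, the sub-sphere measures are images of Lebesgue measure on solid cylinders of height \<open>2\<close>, axis \<open>\<xi>\<close> and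
  radius \<open>r\<close>.  The points of such a cylinder whose radial projection onto the equator is mapped
  into \<open>A\<close> by \<open>g\<close> form the set \<open>cylinder_over \<xi> r g A\<close>.  On the axis, a null set, the radial projection
  \<open>sgn\<close> takes the value \<open>0\<close>.
\<close>

definition cylinder_over :: "'a::euclidean_space \<Rightarrow> real \<Rightarrow> ('a \<Rightarrow> 'a) \<Rightarrow> 'a set \<Rightarrow> 'a set" where
  "cylinder_over \<xi> r g A = {x. \<bar>\<xi> \<bullet> x\<bar> \<le> 1 \<and> norm (hyperplane_proj \<xi> x) \<le> r \<and>
     g (sgn (hyperplane_proj \<xi> x)) \<in> A}"

lemma cylinder_over_borel [measurable]:
  assumes [measurable]: "g \<in> borel_measurable borel" "A \<in> sets borel"
  shows "cylinder_over \<xi> r g A \<in> sets borel"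
  unfolding cylinder_over_def sgn_div_norm by measurable

lemma sets_subsphere_measure [simp, measurable_cong]: "sets (subsphere_measure \<xi> t) = sets borel"
  by (simp add: subsphere_measure_def sphere_measure_def)

lemma space_subsphere_measure [simp]: "space (subsphere_measure \<xi> t) = UNIV"
  using sets_eq_imp_space_eq[OF sets_subsphere_measure[of \<xi> t]] by simp

text \<open>
  The factor \<open>1 / 2\<close> is the reciprocal of the length of the unit ball in the one-dimensional orthogonal
  complement of the hyperplane.
\<close>

lemma emeasure_subsphere_cylinder:
  fixes \<xi> :: "'a::euclidean_space"
  fixes t :: real
  assumes \<xi>: "norm \<xi> = 1" and A [measurable]: "A \<in> sets borel"
  defines "r \<equiv> sqrt (1 - t\<^sup>2)"
  shows "emeasure (subsphere_measure \<xi> t) A = ennreal (real (DIM('a) - 1) / r) *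
    (ennreal (1 / 2) * emeasure lborel (cylinder_over \<xi> r (\<lambda>\<omega>. t *\<^sub>R \<xi> + r *\<^sub>R \<omega>) A))"
proof -
  have [measurable]: "(\<lambda>y. t *\<^sub>R \<xi> + (r / norm y) *\<^sub>R y) \<in> borel_measurable borel"
    by measurable
  let ?V = "{y. \<xi> \<bullet> y = 0}"
  have nz: "\<xi> \<noteq> 0" using \<xi> by auto
  have dim: "dim ?V = DIM('a) - 1" using nz by (rule dim_hyperplane)
  have "DIM('a) - dim ?V = 1" unfolding dim using DIM_positive[where 'a = 'a] by linarith
  then have vol: "unit_ball_vol (real (DIM('a) - dim ?V)) = 2" by simp
  have cp: "closest_point ?V = hyperplane_proj \<xi>" using closest_point_hyperplane[OF \<xi>] by blast
  have tube: "{x. dist x (closest_point ?V x) \<le> 1} = {x. \<bar>\<xi> \<bullet> x\<bar> \<le> 1}" (is "_ = ?T")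
    unfolding cp using \<xi> by (simp add: hyperplane_proj_def dist_norm)
  have [measurable]: "?T \<in> sets borel" by measurable
  have L: "emeasure (subspace_lebesgue ?V) B = ennreal (1 / 2) * emeasure lborel (?T \<inter> hyperplane_proj \<xi> -` B)"
    if [measurable]: "B \<in> sets borel" for B
  proof -
    have "emeasure (distr (restrict_space lborel ?T) borel (hyperplane_proj \<xi>)) B
       = emeasure (restrict_space lborel ?T) (hyperplane_proj \<xi> -` B \<inter> ?T)"
      by (subst emeasure_distr) (auto simp: space_restrict_space intro!: measurable_restrict_space1)
    also have "\<dots> = emeasure lborel (?T \<inter> hyperplane_proj \<xi> -` B)"
      by (subst emeasure_restrict_space) (auto simp: Int_commute)
    finally show ?thesis
      unfolding subspace_lebesgue_def tube unfolding cp by (simp add: vol)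
  qed
  have [simp]: "sets (subspace_lebesgue ?V) = sets borel"
    by (simp add: subspace_lebesgue_def)
  from sets_eq_imp_space_eq[OF this] have [simp]: "space (subspace_lebesgue ?V) = UNIV" by simp
  have "emeasure (distr (restrict_space (subspace_lebesgue ?V) (cball 0 r)) borel
          (\<lambda>y. t *\<^sub>R \<xi> + (r / norm y) *\<^sub>R y)) A
     = emeasure (restrict_space (subspace_lebesgue ?V) (cball 0 r)) ((\<lambda>y. t *\<^sub>R \<xi> + (r / norm y) *\<^sub>R y) -` A \<inter> cball 0 r)"
    by (subst emeasure_distr) (auto simp: space_restrict_space intro!: measurable_restrict_space1 cong: measurable_cong_sets)
  also have "\<dots> = emeasure (subspace_lebesgue ?V) ((\<lambda>y. t *\<^sub>R \<xi> + (r / norm y) *\<^sub>R y) -` A \<inter> cball 0 r)"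
    by (subst emeasure_restrict_space) auto
  also have "\<dots> = ennreal (1 / 2) * emeasure lborel (?T \<inter> hyperplane_proj \<xi> -` ((\<lambda>y. t *\<^sub>R \<xi> + (r / norm y) *\<^sub>R y) -` A \<inter> cball 0 r))"
  proof (rule L)
    have "(\<lambda>y. t *\<^sub>R \<xi> + (r / norm y) *\<^sub>R y) -` A \<inter> space borel \<in> sets borel"
      by measurable
    then show "(\<lambda>y. t *\<^sub>R \<xi> + (r / norm y) *\<^sub>R y) -` A \<inter> cball 0 r \<in> sets borel"
      by simp
  qed
  also have "?T \<inter> hyperplane_proj \<xi> -` ((\<lambda>y. t *\<^sub>R \<xi> + (r / norm y) *\<^sub>R y) -` A \<inter> cball 0 r)
     = cylinder_over \<xi> r (\<lambda>\<omega>. t *\<^sub>R \<xi> + r *\<^sub>R \<omega>) A"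
    by (auto simp: cylinder_over_def sgn_div_norm field_simps)
  finally show ?thesis
    unfolding subsphere_measure_def sphere_measure_def dim r_def by simp
qed

lemma cylinder_over_orthogonal_vimage:
  assumes T: "orthogonal_transformation T" and b: "T b = \<xi>"
  shows "T -` cylinder_over \<xi> r g A = cylinder_over b r (\<lambda>\<omega>. g (T \<omega>)) A"
proof -
  have lin: "linear T" using T by (rule orthogonal_transformation_linear)
  have i: "\<xi> \<bullet> T x = b \<bullet> x" for x using T unfolding b[symmetric] orthogonal_transformation_def
    by blast
  have p: "hyperplane_proj \<xi> (T x) = T (hyperplane_proj b x)" for x
    unfolding hyperplane_proj_def i by (simp add: linear_diff[OF lin] linear_scale[OF lin] b)
  have n: "norm (T x) = norm x" for x using T by (rule orthogonal_transformation_norm)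
  have s: "sgn (T x) = T (sgn x)" for x
    unfolding sgn_div_norm n by (simp add: linear_scale[OF lin])
  show ?thesis unfolding cylinder_over_def vimage_Collect_eq p i s n ..
qed

text \<open>
  Scaling orthogonally to the axis.  A reflection takes the axis to a coordinate axis, and there the scaling
  is a diagonal map.
\<close>

lemma emeasure_cylinder_over_scale:
  fixes \<xi> :: "'a::euclidean_space"
  assumes \<xi>: "norm \<xi> = 1" and r: "r > 0"
    and g [measurable]: "g \<in> borel_measurable borel" and A [measurable]: "A \<in> sets borel"
  shows "emeasure lborel (cylinder_over \<xi> r g A) = ennreal (r ^ (DIM('a) - 1)) * emeasure lborel (cylinder_over \<xi> 1 g A)"
proof -
  obtain b :: 'a where b: "b \<in> Basis" using nonempty_Basis by blast
  then obtain H where H: "orthogonal_transformation H" "H b = \<xi>"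
    using orthogonal_transformation_takes_to[of b \<xi>] \<xi> by auto
  note [measurable] = orthogonal_transformation_imp_borel[OF H(1)]
  define h where "h \<omega> = g (H \<omega>)" for \<omega>
  have [measurable]: "h \<in> borel_measurable borel" unfolding h_def by measurable
  have rot: "emeasure lborel (cylinder_over \<xi> s g A) = emeasure lborel (cylinder_over b s h A)" for s
    unfolding h_def cylinder_over_orthogonal_vimage[OF H, symmetric]
    by (rule emeasure_lborel_orthogonal_vimage[OF H(1), symmetric]) measurable
  define c where "c j = (if j = b then 1 else r)" for j
  define T where "T x = (0::'a) + (\<Sum>j\<in>Basis. (c j * (x \<bullet> j)) *\<^sub>R j)" for x
  have T: "T x = r *\<^sub>R x + ((1 - r) * (b \<bullet> x)) *\<^sub>R b" for x
  proof (rule euclidean_eqI)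
    fix i :: 'a assume i: "i \<in> Basis"
    then have "T x \<bullet> i = c i * (x \<bullet> i)" by (simp add: T_def)
    also have "\<dots> = (r *\<^sub>R x + ((1 - r) * (b \<bullet> x)) *\<^sub>R b) \<bullet> i"
      using i b by (auto simp: c_def inner_add_left inner_Basis inner_commute[of b x] algebra_simps)
    finally show "T x \<bullet> i = (r *\<^sub>R x + ((1 - r) * (b \<bullet> x)) *\<^sub>R b) \<bullet> i" .
  qed
  have prod: "(\<Prod>j\<in>Basis. \<bar>c j\<bar>) = r ^ (DIM('a) - 1)"
    using b r unfolding c_def by (subst prod.remove[OF finite_Basis b]) (simp add: card_Diff_singleton)
  have bT: "b \<bullet> T x = b \<bullet> x" for x
    unfolding T using b by (simp add: inner_simps algebra_simps)
  have pT: "hyperplane_proj b (T x) = r *\<^sub>R hyperplane_proj b x" for x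
    unfolding hyperplane_proj_def bT by (simp add: T algebra_simps)
  have "T -` cylinder_over b r h A = cylinder_over b 1 h A"
    unfolding cylinder_over_def vimage_Collect_eq bT pT sgn_scaleR using r by auto
  moreover have [measurable]: "T \<in> borel_measurable borel" unfolding T[abs_def] by measurable
  moreover have "lborel = density (distr lborel borel T) (\<lambda>_. (\<Prod>j\<in>Basis. \<bar>c j\<bar>))"
    unfolding T_def using r by (intro lborel_affine_euclidean) (auto simp: c_def)
  then have "emeasure lborel (cylinder_over b r h A)
    = emeasure (density (distr lborel borel T) (\<lambda>_. (\<Prod>j\<in>Basis. \<bar>c j\<bar>))) (cylinder_over b r h A)" by simp
  ultimately have "emeasure lborel (cylinder_over b r h A) = ennreal (r ^ (DIM('a) - 1)) * emeasure lborel (cylinder_over b 1 h A)"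
    unfolding prod by (simp add: emeasure_density_const emeasure_distr)
  then show ?thesis by (simp add: rot)
qed

text \<open>
  Along a coordinate axis, Lebesgue measure is a product measure, and the cylinder is the product of an interval
  of length \<open>2\<close> and a unit ball.
\<close>

lemma emeasure_cylinder:
  fixes \<xi> :: "'a::euclidean_space"
  assumes \<xi>: "norm \<xi> = 1"
  shows "emeasure lborel (cylinder_over \<xi> 1 (\<lambda>\<omega>. \<omega>) UNIV) = ennreal (2 * unit_ball_vol (real (DIM('a) - 1)))"
proof -
  obtain b :: 'a where b: "b \<in> Basis" using nonempty_Basis by blast
  then obtain H where H: "orthogonal_transformation H" "H b = \<xi>"
    using orthogonal_transformation_takes_to[of b \<xi>] \<xi> by auto
  let ?C = "cylinder_over b 1 (\<lambda>\<omega>. \<omega>) UNIV"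
  have "emeasure lborel (cylinder_over \<xi> 1 (\<lambda>\<omega>. \<omega>) UNIV) = emeasure lborel (H -` cylinder_over \<xi> 1 (\<lambda>\<omega>. \<omega>) UNIV)"
    by (rule emeasure_lborel_orthogonal_vimage[OF H(1), symmetric]) measurable
  also have "H -` cylinder_over \<xi> 1 (\<lambda>\<omega>. \<omega>) UNIV = ?C"
    unfolding cylinder_over_orthogonal_vimage[OF H] by (simp add: cylinder_over_def)
  also have "emeasure lborel ?C = ennreal (2 * unit_ball_vol (real (DIM('a) - 1)))"
  proof -
    define I where "I = Basis - {b}"
    have I: "finite I" "b \<notin> I" "insert b I = Basis" "card I = DIM('a) - 1"
      using b by (auto simp: I_def card_Diff_singleton)
    interpret product_sigma_finite "\<lambda>_::'a. lborel :: real measure" ..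
    define S where "S f = (\<Sum>j\<in>Basis. f j *\<^sub>R (j::'a))" for f
    let ?B = "{f. sqrt (\<Sum>i\<in>I. (f i)\<^sup>2) \<le> 1} \<inter> space (Pi\<^sub>M I (\<lambda>_. lborel :: real measure))"
    have [measurable]: "S \<in> borel_measurable (Pi\<^sub>M Basis (\<lambda>_. lborel))"
      unfolding S_def by measurable
    have [measurable]: "?C \<in> sets borel" by measurable
    have ind: "indicator ?C (S (f(b := y))) = (indicator {-1..1} y * indicator ?B f :: ennreal)"
      if "f \<in> space (Pi\<^sub>M I (\<lambda>_. lborel :: real measure))" for f y
    proof -
      define z where "z = S (f(b := y))"
      have Sb: "z \<bullet> j = (if j = b then y else f j)" if "j \<in> Basis" for j
        using that unfolding z_def S_def by (subst inner_sum_left_Basis) auto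
      then have y: "b \<bullet> z = y" using b by (simp add: inner_commute[of b])
      have "hyperplane_proj b z \<bullet> j = (if j = b then 0 else f j)" if "j \<in> Basis" for j
        using Sb[OF that] b that y by (auto simp: hyperplane_proj_def inner_diff_left inner_Basis)
      then have "norm (hyperplane_proj b z) = sqrt (\<Sum>j\<in>Basis. (if j = b then 0 else f j)\<^sup>2)"
        by (subst norm_eq_sqrt_inner, subst euclidean_inner) (simp add: power2_eq_square)
      also have "(\<Sum>j\<in>Basis. (if j = b then 0 else f j)\<^sup>2) = (\<Sum>j\<in>I. (f j)\<^sup>2)"
        unfolding I(3)[symmetric] using I(1,2) by (subst sum.insert) (auto intro!: sum.cong)
      finally have n: "norm (hyperplane_proj b z) = sqrt (\<Sum>j\<in>I. (f j)\<^sup>2)" .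
      show ?thesis
        using that unfolding z_def[symmetric] cylinder_over_def indicator_def by (auto simp: y n)
    qed
    have B [measurable]: "?B \<in> sets (Pi\<^sub>M I (\<lambda>_. lborel))" using I(1) by measurable
    have "emeasure lborel ?C = (\<integral>\<^sup>+x. indicator ?C x \<partial>lborel)" by simp
    also have "\<dots> = (\<integral>\<^sup>+f. indicator ?C (S f) \<partial>Pi\<^sub>M Basis (\<lambda>_. lborel))"
      by (subst lborel_eq, fold S_def, subst nn_integral_distr) auto
    also have "\<dots> = (\<integral>\<^sup>+y. (\<integral>\<^sup>+f. indicator ?C (S (f(b := y))) \<partial>Pi\<^sub>M I (\<lambda>_. lborel)) \<partial>lborel)"
      unfolding I(3)[symmetric] by (rule product_nn_integral_insert_rev) (use I in \<open>simp_all\<close>)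
    also have "\<dots> = (\<integral>\<^sup>+y. (\<integral>\<^sup>+f. indicator {-1..1::real} y * indicator ?B f \<partial>Pi\<^sub>M I (\<lambda>_. lborel)) \<partial>lborel)"
      by (intro nn_integral_cong ind)
    also have "\<dots> = (\<integral>\<^sup>+y. indicator {-1..1::real} y * emeasure (Pi\<^sub>M I (\<lambda>_. lborel)) ?B \<partial>lborel)"
      using B by (simp add: nn_integral_cmult)
    also have "\<dots> = 2 * emeasure (Pi\<^sub>M I (\<lambda>_. lborel)) ?B"
      by (simp add: nn_integral_multc)
    also have "emeasure (Pi\<^sub>M I (\<lambda>_. lborel)) ?B = ennreal (unit_ball_vol (real (DIM('a) - 1)))"
      using emeasure_cball_aux[OF I(1), of 1] I(4) by simp
    finally show ?thesis by (simp add: ennreal_mult')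
  qed
  finally show ?thesis .
qed

lemma emeasure_equator:
  fixes \<xi> :: "'a::euclidean_space"
  assumes "norm \<xi> = 1" "A \<in> sets borel"
  shows "emeasure (subsphere_measure \<xi> 0) A
    = ennreal (real (DIM('a) - 1) / 2) * emeasure lborel (cylinder_over \<xi> 1 (\<lambda>\<omega>. \<omega>) A)"
proof -
  have "ennreal (real (DIM('a) - 1) / 2) = ennreal (real (DIM('a) - 1)) * ennreal (1 / 2)"
    by (subst ennreal_mult[symmetric]) auto
  then show ?thesis
    using emeasure_subsphere_cylinder[OF assms, of 0] by (simp add: mult.assoc del: of_nat_diff)
qed

text \<open>
  The sub-sphere at height \<open>t\<close> is the equator, scaled by \<open>r\<close> and shifted; the scaling multiplies the
  surface measure by a power of \<open>r\<close> whose exponent is the dimension of the equator.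
\<close>

lemma subsphere_measure_equator:
  fixes \<xi> :: "'a::euclidean_space" and t :: real
  assumes \<xi>: "norm \<xi> = 1" and t: "\<bar>t\<bar> < 1" and d: "DIM('a) \<ge> 2"
  defines "r \<equiv> sqrt (1 - t\<^sup>2)"
  shows "subsphere_measure \<xi> t =
    density (distr (subsphere_measure \<xi> 0) borel (\<lambda>\<omega>. t *\<^sub>R \<xi> + r *\<^sub>R \<omega>)) (\<lambda>_. ennreal (r ^ (DIM('a) - 2)))"
proof (rule measure_eqI)
  have "t\<^sup>2 < 1" using t by (simp add: abs_square_less_1)
  then have r: "r > 0" by (simp add: r_def)
  fix A assume "A \<in> sets (subsphere_measure \<xi> t)"
  then have A [measurable]: "A \<in> sets borel" by simp
  define g where "g \<omega> = t *\<^sub>R \<xi> + r *\<^sub>R \<omega>" for \<omega>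
  have [measurable]: "g \<in> borel_measurable borel" unfolding g_def by measurable
  have gA: "g -` A \<in> sets borel" using measurable_sets[of g borel borel A] by simp
  define e where "e = emeasure lborel (cylinder_over \<xi> 1 g A)"
  have "emeasure (subsphere_measure \<xi> t) A = ennreal (real (DIM('a) - 1) / r) *
    (ennreal (1 / 2) * (ennreal (r ^ (DIM('a) - 1)) * e))"
    unfolding emeasure_subsphere_cylinder[OF \<xi> A] e_def
    unfolding r_def[symmetric] g_def[symmetric, abs_def]
    by (subst emeasure_cylinder_over_scale[OF \<xi> r]) simp_all
  also have "\<dots> = ennreal (real (DIM('a) - 1) / r * (1 / 2) * r ^ (DIM('a) - 1)) * e"
  proof -
    have *: "ennreal (a * (1 / 2) * c) = ennreal a * ennreal (1 / 2) * ennreal c" if "a \<ge> 0" "c \<ge> 0" for a c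
      using that by (subst ennreal_mult, simp, simp, subst ennreal_mult) simp_all
    show ?thesis
      by (subst *) (use r in \<open>simp_all only: mult.assoc divide_nonneg_pos of_nat_0_le_iff zero_le_power less_imp_le\<close>)
  qed
  also have "real (DIM('a) - 1) / r * (1 / 2) * r ^ (DIM('a) - 1) = r ^ (DIM('a) - 2) * (real (DIM('a) - 1) / 2)"
  proof -
    have "r ^ (DIM('a) - 1) = r * r ^ (DIM('a) - 2)"
    proof -
      have "DIM('a) - 1 = Suc (DIM('a) - 2)" using d by arith
      then show ?thesis by (simp only: power_Suc)
    qed
    then show ?thesis using r by (simp del: of_nat_diff)
  qed
  also have "ennreal \<dots> * e = ennreal (r ^ (DIM('a) - 2)) * (ennreal (real (DIM('a) - 1) / 2) * e)"
    by (subst ennreal_mult) (use r in \<open>simp_all only: mult.assoc zero_le_power less_imp_le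
          divide_nonneg_pos of_nat_0_le_iff zero_less_numeral\<close>)
  also have "ennreal (real (DIM('a) - 1) / 2) * e = emeasure (subsphere_measure \<xi> 0) (g -` A)"
    unfolding emeasure_equator[OF \<xi> gA] e_def by (simp add: cylinder_over_def)
  finally have "emeasure (subsphere_measure \<xi> t) A = ennreal (r ^ (DIM('a) - 2)) * emeasure (subsphere_measure \<xi> 0) (g -` A)" .
  also have "\<dots> = emeasure (density (distr (subsphere_measure \<xi> 0) borel g) (\<lambda>_. ennreal (r ^ (DIM('a) - 2)))) A"
    by (simp add: emeasure_density_const emeasure_distr)
  finally show "emeasure (subsphere_measure \<xi> t) A =
    emeasure (density (distr (subsphere_measure \<xi> 0) borel (\<lambda>\<omega>. t *\<^sub>R \<xi> + r *\<^sub>R \<omega>)) (\<lambda>_. ennreal (r ^ (DIM('a) - 2)))) A"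
    by (simp add: g_def[abs_def])
qed simp

lemma measure_equator:
  fixes \<xi> :: "'a::euclidean_space"
  assumes \<xi>: "norm \<xi> = 1" and d: "DIM('a) \<ge> 2"
  shows "finite_measure (subsphere_measure \<xi> 0)"
    and "measure (subsphere_measure \<xi> 0) UNIV = sphere_area (DIM('a) - 1)"
proof -
  define D where "D = real (DIM('a) - 1)"
  have D: "D > 0" using d by (simp add: D_def)
  have "emeasure (subsphere_measure \<xi> 0) UNIV = ennreal (D / 2) * ennreal (2 * unit_ball_vol D)"
    using emeasure_equator[OF \<xi>, of UNIV] emeasure_cylinder[OF \<xi>] by (simp add: D_def)
  also have "\<dots> = ennreal (D * unit_ball_vol D)" using D by (simp flip: ennreal_mult)
  also have "D * unit_ball_vol D = sphere_area (DIM('a) - 1)"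
  proof -
    have G: "Gamma (D / 2 + 1) = (D / 2) * Gamma (D / 2)"
      using D by (intro Gamma_plus1) (auto elim!: nonpos_Ints_cases)
    moreover have "Gamma (D / 2) > 0" using D by (intro Gamma_real_pos) simp
    ultimately show ?thesis using D unfolding unit_ball_vol_def sphere_area_def D_def[symmetric] G
      by (simp add: field_simps)
  qed
  finally have e: "emeasure (subsphere_measure \<xi> 0) UNIV = ennreal (sphere_area (DIM('a) - 1))" .
  then show "finite_measure (subsphere_measure \<xi> 0)" by (intro finite_measureI) simp
  have "sphere_area (DIM('a) - 1) \<ge> 0"
    using D unfolding sphere_area_def D_def by (intro divide_nonneg_nonneg less_imp_le[OF Gamma_real_pos]) auto
  then show "measure (subsphere_measure \<xi> 0) UNIV = sphere_area (DIM('a) - 1)"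
    using e by (simp add: measure_def)
qed

lemma distr_equator:
  fixes \<xi> :: "'a::euclidean_space"
  assumes \<xi>: "norm \<xi> = 1" and T: "orthogonal_transformation T" "T \<xi> = \<xi>"
  shows "distr (subsphere_measure \<xi> 0) borel T = subsphere_measure \<xi> 0"
proof (rule measure_eqI)
  note [measurable] = orthogonal_transformation_imp_borel[OF T(1)]
  fix A assume "A \<in> sets (distr (subsphere_measure \<xi> 0) borel T)"
  then have A [measurable]: "A \<in> sets borel" by simp
  have TA: "T -` A \<in> sets borel" using measurable_sets[of T borel borel A] by simp
  have "emeasure (distr (subsphere_measure \<xi> 0) borel T) A = emeasure (subsphere_measure \<xi> 0) (T -` A)"
    by (simp add: emeasure_distr)
  also have "\<dots> = ennreal (real (DIM('a) - 1) / 2) * emeasure lborel (T -` cylinder_over \<xi> 1 (\<lambda>\<omega>. \<omega>) A)"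
    unfolding emeasure_equator[OF \<xi> TA] cylinder_over_orthogonal_vimage[OF T] by (simp add: cylinder_over_def)
  also have "\<dots> = emeasure (subsphere_measure \<xi> 0) A"
    unfolding emeasure_equator[OF \<xi> A] by (subst emeasure_lborel_orthogonal_vimage[OF T(1)]) measurable
  finally show "emeasure (distr (subsphere_measure \<xi> 0) borel T) A = emeasure (subsphere_measure \<xi> 0) A" .
qed simp

text \<open>
  The axis of the cylinder, where the radial projection misses the equator, has measure zero.
\<close>

lemma AE_equator:
  fixes \<xi> :: "'a::euclidean_space"
  assumes \<xi>: "norm \<xi> = 1" and d: "DIM('a) \<ge> 2"
  shows "AE \<omega> in subsphere_measure \<xi> 0. norm \<omega> = 1 \<and> \<xi> \<bullet> \<omega> = 0"
proof -
  let ?N = "{\<omega>. \<not> (norm \<omega> = 1 \<and> \<xi> \<bullet> \<omega> = 0)}"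
  have N: "?N \<in> sets borel" by measurable
  let ?Z = "{x. hyperplane_proj \<xi> x = 0}"
  have Z [measurable]: "?Z \<in> sets borel" by measurable
  have "?Z \<subseteq> span {\<xi>}"
  proof
    fix x assume "x \<in> ?Z"
    then have "x = (\<xi> \<bullet> x) *\<^sub>R \<xi>" by (simp add: hyperplane_proj_def)
    then show "x \<in> span {\<xi>}" by (metis span_base span_scale singletonI)
  qed
  then have "dim ?Z \<le> 1"
    using dim_subset[of ?Z "span {\<xi>}"] \<xi> by (auto simp: dim_singleton split: if_splits)
  then have "negligible ?Z" using d by (intro negligible_lowdim) simp
  then have "emeasure lborel ?Z = 0" using Z by (simp add: negligible_iff_emeasure0)
  moreover have "cylinder_over \<xi> 1 (\<lambda>\<omega>. \<omega>) ?N \<subseteq> ?Z"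
  proof
    fix x assume x: "x \<in> cylinder_over \<xi> 1 (\<lambda>\<omega>. \<omega>) ?N"
    have "\<xi> \<bullet> hyperplane_proj \<xi> x = 0"
      using \<xi> by (simp add: hyperplane_proj_def inner_diff_right norm_eq_1)
    then have "\<xi> \<bullet> sgn (hyperplane_proj \<xi> x) = 0" by (simp add: sgn_div_norm)
    then show "x \<in> ?Z" using x by (auto simp: cylinder_over_def norm_sgn split: if_splits)
  qed
  ultimately have "emeasure lborel (cylinder_over \<xi> 1 (\<lambda>\<omega>. \<omega>) ?N) = 0"
    using emeasure_mono[of "cylinder_over \<xi> 1 (\<lambda>\<omega>. \<omega>) ?N" ?Z lborel] Z by simp
  then have "emeasure (subsphere_measure \<xi> 0) ?N = 0"
    unfolding emeasure_equator[OF \<xi> N] by simp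
  then show ?thesis using N by (intro AE_I[of _ _ ?N]) auto
qed

section \<open>Differentiation under the integral sign\<close>

text \<open>
  The bound \<open>C\<close> on the derivatives bounds the difference quotients, by the mean value inequality, and so
  dominated convergence applies.
\<close>

lemma has_vector_derivative_integral:
  fixes h :: "real \<Rightarrow> 'b \<Rightarrow> 'c::{banach, second_countable_topology}"
  assumes M: "finite_measure M" and e: "e > 0"
    and int: "\<And>t. t \<in> ball t0 e \<Longrightarrow> integrable M (h t)"
    and meas: "h' t0 \<in> borel_measurable M"
    and deriv: "\<And>t \<omega>. t \<in> ball t0 e \<Longrightarrow> ((\<lambda>t. h t \<omega>) has_vector_derivative h' t \<omega>) (at t)"
    and bound: "AE \<omega> in M. \<forall>t\<in>ball t0 e. norm (h' t \<omega>) \<le> C"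
  shows "((\<lambda>t. LINT \<omega>|M. h t \<omega>) has_vector_derivative (LINT \<omega>|M. h' t0 \<omega>)) (at t0)"
proof -
  interpret finite_measure M by fact
  let ?S = "ball t0 e"
  define f where "f t = (LINT \<omega>|M. h t \<omega>)" for t
  define D where "D = (LINT \<omega>|M. h' t0 \<omega>)"
  define q where "q t \<omega> = (h t \<omega> - h t0 \<omega>) /\<^sub>R (t - t0)" for t \<omega>
  have t0: "t0 \<in> ?S" using e by simp
  have "((\<lambda>t. norm ((f t - f t0) - (t - t0) *\<^sub>R D) / norm (t - t0)) \<longlongrightarrow> 0) (at t0 within ?S)"
    unfolding tendsto_at_iff_sequentially
  proof (intro allI impI)
    fix X assume X: "\<forall>i. X i \<in> ?S - {t0}" "X \<longlonglongrightarrow> t0"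
    have "(\<lambda>i. LINT \<omega>|M. q (X i) \<omega>) \<longlonglongrightarrow> D"
      unfolding D_def
    proof (rule integral_dominated_convergence[where w = "\<lambda>_. C"])
      show "(\<lambda>\<omega>. q (X i) \<omega>) \<in> borel_measurable M" for i
        unfolding q_def using int[of "X i"] int[OF t0] X(1)
          by (auto intro!: borel_measurable_scaleR borel_measurable_diff)
      show "AE \<omega> in M. norm (q (X i) \<omega>) \<le> C" for i
        using bound
      proof eventually_elim
        fix \<omega> assume b: "\<forall>t\<in>?S. norm (h' t \<omega>) \<le> C"
        have "norm (h (X i) \<omega> - h t0 \<omega>) \<le> C * norm (X i - t0)"
        proof (rule differentiable_bound[where S = ?S and f' = "\<lambda>t v. v *\<^sub>R h' t \<omega>"])
          show "convex ?S" by simp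
          show "((\<lambda>t. h t \<omega>) has_derivative (\<lambda>v. v *\<^sub>R h' t \<omega>)) (at t within ?S)" if "t \<in> ?S" for t
            using deriv[OF that, of \<omega>] unfolding has_vector_derivative_def
              by (rule has_derivative_at_withinI)
          show "onorm (\<lambda>v. v *\<^sub>R h' t \<omega>) \<le> C" if "t \<in> ?S" for t
          proof (rule onorm_le)
            fix v :: real
            have "\<bar>v\<bar> * norm (h' t \<omega>) \<le> \<bar>v\<bar> * C" using b that
              by (intro mult_left_mono) auto
            then show "norm (v *\<^sub>R h' t \<omega>) \<le> C * norm v" by (simp add: mult.commute)
          qed
          show "X i \<in> ?S" "t0 \<in> ?S" using X(1) t0 by auto
        qed
        moreover have "norm (X i - t0) > 0" using X(1) by simp
        ultimately show "norm (q (X i) \<omega>) \<le> C"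
          unfolding q_def by (simp add: divide_simps mult.commute)
      qed
      show "AE \<omega> in M. (\<lambda>i. q (X i) \<omega>) \<longlonglongrightarrow> h' t0 \<omega>"
      proof (intro AE_I2)
        fix \<omega>
        have "((\<lambda>t. h t \<omega>) has_vector_derivative h' t0 \<omega>) (at t0 within ?S)"
          using deriv[OF t0, of \<omega>] by (rule has_vector_derivative_at_within)
        then have "((\<lambda>t. norm ((h t \<omega> - h t0 \<omega>) - (t - t0) *\<^sub>R h' t0 \<omega>) / norm (t - t0)) \<longlongrightarrow> 0) (at t0 within ?S)"
          unfolding has_vector_derivative_def has_derivative_iff_norm by simp
        then have "(\<lambda>i. norm ((h (X i) \<omega> - h t0 \<omega>) - (X i - t0) *\<^sub>R h' t0 \<omega>) / norm (X i - t0)) \<longlonglongrightarrow> 0"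
          unfolding tendsto_at_iff_sequentially using X by (auto simp: o_def)
        moreover have "norm ((h (X i) \<omega> - h t0 \<omega>) - (X i - t0) *\<^sub>R h' t0 \<omega>) / norm (X i - t0) = norm (q (X i) \<omega> - h' t0 \<omega>)" for i
        proof -
          have nz: "X i - t0 \<noteq> 0" using X(1) by auto
          then have "(h (X i) \<omega> - h t0 \<omega>) - (X i - t0) *\<^sub>R h' t0 \<omega> = (X i - t0) *\<^sub>R (q (X i) \<omega> - h' t0 \<omega>)"
            unfolding q_def by (simp add: scaleR_diff_right)
          then show ?thesis using nz by simp
        qed
        ultimately show "(\<lambda>i. q (X i) \<omega>) \<longlonglongrightarrow> h' t0 \<omega>"
          by (simp add: tendsto_norm_zero_iff flip: LIM_zero_iff[of "\<lambda>i. q (X i) \<omega>"])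
      qed
    qed (use meas in auto)
    then have "(\<lambda>i. norm ((LINT \<omega>|M. q (X i) \<omega>) - D)) \<longlonglongrightarrow> 0"
      by (simp add: tendsto_norm_zero_iff LIM_zero_iff)
    moreover have "norm ((f (X i) - f t0) - (X i - t0) *\<^sub>R D) / norm (X i - t0) = norm ((LINT \<omega>|M. q (X i) \<omega>) - D)" for i
    proof -
      have nz: "X i - t0 \<noteq> 0" using X(1) by auto
      have "(LINT \<omega>|M. q (X i) \<omega>) = (f (X i) - f t0) /\<^sub>R (X i - t0)"
        unfolding q_def f_def using int[of "X i"] int[OF t0] X(1) by simp
      then have "(f (X i) - f t0) - (X i - t0) *\<^sub>R D = (X i - t0) *\<^sub>R ((LINT \<omega>|M. q (X i) \<omega>) - D)"
        using nz by (simp add: scaleR_diff_right)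
      then show ?thesis using nz by simp
    qed
    ultimately show "((\<lambda>t. norm ((f t - f t0) - (t - t0) *\<^sub>R D) / norm (t - t0)) \<circ> X) \<longlonglongrightarrow> 0"
      by (simp add: o_def)
  qed
  then have "(f has_vector_derivative D) (at t0 within ?S)"
    unfolding has_vector_derivative_def has_derivative_iff_norm
    by (simp add: bounded_linear_scaleR_left)
  then show ?thesis
    using t0 by (simp add: at_within_open[OF t0 open_ball] f_def[abs_def] D_def)
qed

section \<open>Harmonic homogeneous polynomials\<close>

text \<open>
  Harmonic polynomials that satisfy Euler's identity for the degree \<open>m\<close>.  The degree is a real number, so that
  a derivative has degree \<open>m - 1\<close> without exception: only the zero polynomial has degree \<open>- 1\<close>.
\<close>

definition harmonic_of_degree :: "real \<Rightarrow> ('a::euclidean_space \<Rightarrow> complex) \<Rightarrow> bool" where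
  "harmonic_of_degree m F \<longleftrightarrow> polynomial_function F \<and> (\<forall>x. laplacian F x = 0) \<and>
     (\<forall>x. directional_derivative x F x = of_real m * F x)"

text \<open>
  Euler's identity, differentiated in direction \<open>u\<close>; on the left, the inner direction is frozen at the point
  \<open>x\<close> of evaluation.
\<close>

lemma harmonic_euler2:
  assumes F: "harmonic_of_degree m F"
  shows "directional_derivative u (directional_derivative x F) x = of_real (m - 1) * directional_derivative u F x"
proof -
  have p: "polynomial_function F" using F by (simp add: harmonic_of_degree_def)
  have "(\<lambda>x. directional_derivative x F x) = (\<lambda>x. of_real m * F x)"
    using F by (simp add: harmonic_of_degree_def)
  then have "directional_derivative u (\<lambda>x. directional_derivative x F x) x = of_real m * directional_derivative u F x"
    by (simp add: directional_derivative_cmult[OF p])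
  with directional_derivative_along(2)[OF p, of "\<lambda>x. x" u x] show ?thesis
    by (simp add: linear_id[unfolded id_def] algebra_simps)
qed

lemma harmonic_directional_derivative:
  assumes F: "harmonic_of_degree m F"
  shows "harmonic_of_degree (m - 1) (directional_derivative v F)"
  unfolding harmonic_of_degree_def
proof (intro conjI allI)
  have p: "polynomial_function F" using F by (simp add: harmonic_of_degree_def)
  note pd = polynomial_directional_derivative
  show "polynomial_function (directional_derivative v F)" by (rule pd[OF p])
  fix x
  have "laplacian (directional_derivative v F) x
      = (\<Sum>b\<in>Basis. directional_derivative v (directional_derivative b (directional_derivative b F)) x)"
    unfolding laplacian_def
  proof (rule sum.cong[OF refl])
    fix b :: 'a
    show "directional_derivative b (directional_derivative b (directional_derivative v F)) x
      = directional_derivative v (directional_derivative b (directional_derivative b F)) x"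
      by (subst directional_derivative_commute[OF p, of b v], subst directional_derivative_commute[OF pd[OF p], of b v]) simp
  qed
  also have "\<dots> = directional_derivative v (laplacian F) x"
    unfolding laplacian_def[abs_def] by (rule directional_derivative_sum[symmetric]) (auto intro: pd p)
  also have "laplacian F = (\<lambda>x. 0)" using F by (auto simp: harmonic_of_degree_def)
  finally show "laplacian (directional_derivative v F) x = 0" by simp
  have "directional_derivative x (directional_derivative v F) x = directional_derivative v (directional_derivative x F) x"
    by (subst directional_derivative_commute[OF p]) simp
  then show "directional_derivative x (directional_derivative v F) x = of_real (m - 1) * directional_derivative v F x"
    using harmonic_euler2[OF F] by simp
qed

text \<open>
  Along each ray, \<open>s *\<^sub>R F (s *\<^sub>R x)\<close> is constant in \<open>s\<close>, and it vanishes at \<open>s = 0\<close>.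
\<close>

lemma harmonic_of_degree_minus_1:
  fixes F :: "'a::euclidean_space \<Rightarrow> complex"
  assumes F: "harmonic_of_degree (- 1) F"
  shows "F x = 0"
proof -
  have p: "polynomial_function F" using F by (simp add: harmonic_of_degree_def)
  have d: "((\<lambda>s. s *\<^sub>R F (s *\<^sub>R x)) has_vector_derivative 0) (at s)" for s
  proof -
    interpret D: linear "\<lambda>v. directional_derivative v F (s *\<^sub>R x)"
      by (rule linear_directional_derivative[OF p])
    have "((\<lambda>s. s *\<^sub>R x) has_vector_derivative x) (at s)" by (auto intro!: derivative_eq_intros)
    from polynomial_chain_rule[OF p this]
    have "((\<lambda>s. s *\<^sub>R F (s *\<^sub>R x)) has_vector_derivative s *\<^sub>R directional_derivative x F (s *\<^sub>R x) + 1 *\<^sub>R F (s *\<^sub>R x)) (at s)"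
      by (intro has_vector_derivative_scaleR) auto
    moreover have "s *\<^sub>R directional_derivative x F (s *\<^sub>R x) = - F (s *\<^sub>R x)"
      using F unfolding D.scaleR[symmetric] by (simp add: harmonic_of_degree_def)
    ultimately show ?thesis by simp
  qed
  obtain c where c: "\<And>s::real. s *\<^sub>R F (s *\<^sub>R x) = c"
    using has_vector_derivative_zero_constant[of UNIV "\<lambda>s. s *\<^sub>R F (s *\<^sub>R x)"] d by auto
  from c[of 0] c[of 1] show ?thesis by simp
qed

lemma harmonic_of_degree_0:
  fixes F :: "'a::euclidean_space \<Rightarrow> complex"
  assumes F: "harmonic_of_degree 0 F"
  shows "F x = F y"
proof -
  have p: "polynomial_function F" using F by (simp add: harmonic_of_degree_def)
  have "directional_derivative v F x = 0" for v x
    using harmonic_of_degree_minus_1[of "directional_derivative v F"] harmonic_directional_derivative[OF F, of v]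
      by simp
  then have "(F has_derivative (\<lambda>v. 0)) (at x)" for x
    using polynomial_has_derivative[OF p, of x] by simp
  then show ?thesis by (intro has_derivative_zero_unique[of UNIV F]) auto
qed

lemma spherical_harmonics_harmonic_of_degree:
  assumes p: "polynomial_function p" "\<forall>x. laplacian p x = 0" "\<forall>c::real. \<forall>x. p (c *\<^sub>R x) = of_real c ^ n * p x"
  shows "harmonic_of_degree (real n) (p :: 'a::euclidean_space \<Rightarrow> complex)"
  unfolding harmonic_of_degree_def
proof (intro conjI allI p(1) p(2)[rule_format])
  fix x :: 'a
  have "((\<lambda>c. c *\<^sub>R x) has_vector_derivative x) (at 1)" by (auto intro!: derivative_eq_intros)
  from polynomial_chain_rule[OF p(1) this]
  have "((\<lambda>c. p (c *\<^sub>R x)) has_vector_derivative directional_derivative x p x) (at 1)" by simp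
  moreover have "((\<lambda>c. c ^ n *\<^sub>R p x) has_vector_derivative real n *\<^sub>R p x) (at 1)"
    by (auto intro!: derivative_eq_intros)
  moreover have "(\<lambda>c. p (c *\<^sub>R x)) = (\<lambda>c. c ^ n *\<^sub>R p x)"
    using p(3) by (simp add: scaleR_conv_of_real)
  ultimately have "directional_derivative x p x = real n *\<^sub>R p x"
    using vector_derivative_unique_at by metis
  then show "directional_derivative x p x = of_real (real n) * p x" by (simp add: scaleR_conv_of_real)
qed

section \<open>The Laplacian as a sum of squared infinitesimal rotations\<close>

text \<open>
  The map \<open>A v w\<close> generates the rotations in the plane of the orthonormal vectors \<open>v\<close> and \<open>w\<close>.  With a
  bilinear form \<open>B\<close> in the place of the second derivative and a linear form \<open>L\<close> in the place of the first,
  this is the formula of the spherical Laplacian on the span of \<open>E\<close>.  Each plane is counted twice on the left.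
\<close>

lemma sum_rotation_generators:
  fixes B :: "'a::euclidean_space \<Rightarrow> 'a \<Rightarrow> complex" and L :: "'a \<Rightarrow> complex" and y :: 'a
  assumes L: "linear L" and B1: "\<And>u. linear (\<lambda>v. B v u)" and B2: "\<And>u. linear (B u)"
    and E: "finite E" "\<And>v w. v \<in> E \<Longrightarrow> w \<in> E \<Longrightarrow> v \<bullet> w = (if v = w then 1 else 0)"
  defines "A \<equiv> \<lambda>v w x. (x \<bullet> v) *\<^sub>R w - (x \<bullet> w) *\<^sub>R v"
  defines "z \<equiv> \<Sum>v\<in>E. (y \<bullet> v) *\<^sub>R v"
  shows "(\<Sum>v\<in>E. \<Sum>w\<in>E. B (A v w y) (A v w y) + L (A v w (A v w y)))
    = 2 * of_real (\<Sum>v\<in>E. (y \<bullet> v)\<^sup>2) * (\<Sum>w\<in>E. B w w) - 2 * B z z - 2 * (of_nat (card E) - 1) * L z"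
proof -
  interpret L: linear L by fact
  interpret B1: linear "\<lambda>v. B v u" for u by (rule B1)
  interpret B2: linear "B u" for u by (rule B2)
  define \<alpha> where "\<alpha> v = complex_of_real (y \<bullet> v)" for v
  have Lz: "L z = (\<Sum>v\<in>E. \<alpha> v * L v)"
    unfolding z_def L.sum L.scaleR by (simp add: \<alpha>_def scaleR_conv_of_real)
  have Bz: "B z z = (\<Sum>v\<in>E. \<Sum>w\<in>E. \<alpha> v * \<alpha> w * B v w)"
  proof -
    have 1: "B z u = (\<Sum>v\<in>E. \<alpha> v * B v u)" for u
      unfolding z_def B1.sum B1.scaleR by (simp add: \<alpha>_def scaleR_conv_of_real)
    have 2: "B u z = (\<Sum>w\<in>E. \<alpha> w * B u w)" for u
      unfolding z_def B2.sum B2.scaleR by (simp add: \<alpha>_def scaleR_conv_of_real)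
    show ?thesis by (subst 1, subst 2) (simp add: sum_distrib_left mult.assoc)
  qed
  have "B (A v w y) (A v w y) + L (A v w (A v w y))
     = ((\<alpha> v)\<^sup>2 * B w w + (\<alpha> w)\<^sup>2 * B v v - \<alpha> v * \<alpha> w * B v w - \<alpha> w * \<alpha> v * B w v)
       + ((if v = w then \<alpha> v * L w + \<alpha> w * L v else 0) - \<alpha> w * L w - \<alpha> v * L v)"
    if "v \<in> E" "w \<in> E" for v w
  proof -
    have 1: "A v w y \<bullet> v = (if v = w then y \<bullet> v else 0) - y \<bullet> w" "A v w y \<bullet> w = y \<bullet> v - (if v = w then y \<bullet> w else 0)"
      unfolding A_def using E(2)[OF that] E(2)[OF that(2,1)] E(2)[OF that(1) that(1)] E(2)[OF that(2) that(2)]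
      by (auto simp: inner_diff_left)
    have "L (A v w (A v w y)) = (A v w y \<bullet> v) *\<^sub>R L w - (A v w y \<bullet> w) *\<^sub>R L v"
      by (subst A_def) (simp add: L.diff L.scaleR)
    also have "\<dots> = (if v = w then \<alpha> v * L w + \<alpha> w * L v else 0) - \<alpha> w * L w - \<alpha> v * L v"
      unfolding 1 by (auto simp: \<alpha>_def scaleR_conv_of_real algebra_simps)
    finally have 2: "L (A v w (A v w y)) = \<dots>" .
    have "B (A v w y) (A v w y) = (\<alpha> v)\<^sup>2 * B w w + (\<alpha> w)\<^sup>2 * B v v - \<alpha> v * \<alpha> w * B v w - \<alpha> w * \<alpha> v * B w v"
      unfolding A_def B1.diff B2.diff B1.scaleR B2.scaleR
      by (simp add: \<alpha>_def scaleR_conv_of_real algebra_simps power2_eq_square)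
    with 2 show ?thesis by simp
  qed
  then have "(\<Sum>v\<in>E. \<Sum>w\<in>E. B (A v w y) (A v w y) + L (A v w (A v w y)))
    = (\<Sum>v\<in>E. \<Sum>w\<in>E. ((\<alpha> v)\<^sup>2 * B w w + (\<alpha> w)\<^sup>2 * B v v - \<alpha> v * \<alpha> w * B v w - \<alpha> w * \<alpha> v * B w v)
       + ((if v = w then \<alpha> v * L w + \<alpha> w * L v else 0) - \<alpha> w * L w - \<alpha> v * L v))"
    by (intro sum.cong refl)
  also have "\<dots> = (\<Sum>v\<in>E. \<Sum>w\<in>E. (\<alpha> v)\<^sup>2 * B w w) + (\<Sum>v\<in>E. \<Sum>w\<in>E. (\<alpha> w)\<^sup>2 * B v v)
      - (\<Sum>v\<in>E. \<Sum>w\<in>E. \<alpha> v * \<alpha> w * B v w) - (\<Sum>v\<in>E. \<Sum>w\<in>E. \<alpha> w * \<alpha> v * B w v)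
      + ((\<Sum>v\<in>E. \<Sum>w\<in>E. if v = w then \<alpha> v * L w + \<alpha> w * L v else 0)
         - (\<Sum>v\<in>E. \<Sum>w\<in>E. \<alpha> w * L w) - (\<Sum>v\<in>E. \<Sum>w\<in>E. \<alpha> v * L v))"
    by (simp only: sum.distrib sum_subtractf)
  also have "(\<Sum>v\<in>E. \<Sum>w\<in>E. (\<alpha> w)\<^sup>2 * B v v) = (\<Sum>v\<in>E. \<Sum>w\<in>E. (\<alpha> v)\<^sup>2 * B w w)"
    by (rule sum.swap)
  also have "(\<Sum>v\<in>E. \<Sum>w\<in>E. (\<alpha> v)\<^sup>2 * B w w) = of_real (\<Sum>v\<in>E. (y \<bullet> v)\<^sup>2) * (\<Sum>w\<in>E. B w w)"
    by (simp add: \<alpha>_def sum_product)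
  also have "(\<Sum>v\<in>E. \<Sum>w\<in>E. \<alpha> w * \<alpha> v * B w v) = B z z" unfolding Bz
    by (rule sum.swap)
  also have "(\<Sum>v\<in>E. \<Sum>w\<in>E. \<alpha> v * \<alpha> w * B v w) = B z z" unfolding Bz ..
  also have "(\<Sum>v\<in>E. \<Sum>w\<in>E. if v = w then \<alpha> v * L w + \<alpha> w * L v else 0) = 2 * L z"
    using E(1) by (simp add: Lz sum_distrib_left mult_ac)
  also have "(\<Sum>v\<in>E. \<Sum>w\<in>E. \<alpha> w * L w) = of_nat (card E) * L z" by (simp add: Lz)
  also have "(\<Sum>v\<in>E. \<Sum>w\<in>E. \<alpha> v * L v) = of_nat (card E) * L z"
    by (simp add: Lz flip: sum_distrib_left)
  finally show ?thesis by (simp add: algebra_simps)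
qed

lemma trace_orthonormal:
  fixes B :: "'a::euclidean_space \<Rightarrow> 'a \<Rightarrow> complex"
  assumes B1: "\<And>u. linear (\<lambda>v. B v u)" and B2: "\<And>u. linear (B u)"
    and E: "finite E" "\<And>v w. v \<in> E \<Longrightarrow> w \<in> E \<Longrightarrow> v \<bullet> w = (if v = w then 1 else 0)"
    and expand: "\<And>x. (\<Sum>v\<in>E. (x \<bullet> v) *\<^sub>R v) = x"
  shows "(\<Sum>b\<in>Basis. B b b) = (\<Sum>v\<in>E. B v v)"
proof -
  interpret B1: linear "\<lambda>v. B v u" for u by (rule B1)
  interpret B2: linear "B u" for u by (rule B2)
  have "(\<Sum>b\<in>Basis. B b b) = (\<Sum>b\<in>Basis. \<Sum>v\<in>E. \<Sum>w\<in>E. ((b \<bullet> v) * (b \<bullet> w)) *\<^sub>R B v w)"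
  proof (rule sum.cong[OF refl])
    fix b :: 'a
    have 1: "B b u = (\<Sum>v\<in>E. (b \<bullet> v) *\<^sub>R B v u)" for u
      by (subst (1) expand[of b, symmetric]) (simp only: B1.sum B1.scaleR)
    have 2: "B u b = (\<Sum>w\<in>E. (b \<bullet> w) *\<^sub>R B u w)" for u
      by (subst (1) expand[of b, symmetric]) (simp only: B2.sum B2.scaleR)
    show "B b b = (\<Sum>v\<in>E. \<Sum>w\<in>E. ((b \<bullet> v) * (b \<bullet> w)) *\<^sub>R B v w)"
      by (subst 1, subst 2) (simp add: scaleR_sum_right)
  qed
  also have "\<dots> = (\<Sum>v\<in>E. \<Sum>w\<in>E. (v \<bullet> w) *\<^sub>R B v w)"
    by (subst sum.swap, rule sum.cong[OF refl], subst sum.swap, rule sum.cong[OF refl])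
       (subst euclidean_inner, simp add: inner_commute[of _ "_ :: 'a"] scaleR_sum_left)
  also have "\<dots> = (\<Sum>v\<in>E. \<Sum>w\<in>E. if v = w then B v v else 0)"
    by (intro sum.cong refl) (auto simp: E(2))
  also have "\<dots> = (\<Sum>v\<in>E. B v v)" using E(1) by simp
  finally show ?thesis .
qed

text \<open>
  The spherical Laplacian of the equatorial hyperplane, applied to a harmonic homogeneous polynomial at a point
  of the unit sphere: harmonicity trades the derivatives within the hyperplane for the second derivative in
  direction \<open>\<xi>\<close>, and Euler's identity removes the radial derivatives.
\<close>

lemma harmonic_rotation_identity:
  fixes F :: "'a::euclidean_space \<Rightarrow> complex" and \<xi> y :: 'a and E :: "'a set"
  assumes F: "harmonic_of_degree m F"
    and E: "finite E" "\<xi> \<notin> E" "\<And>v w. v \<in> insert \<xi> E \<Longrightarrow> w \<in> insert \<xi> E \<Longrightarrow> v \<bullet> w = (if v = w then 1 else 0)"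
    and expand: "\<And>x. (\<Sum>v\<in>insert \<xi> E. (x \<bullet> v) *\<^sub>R v) = x"
    and card: "card E = DIM('a) - 1" and y: "norm y = 1"
  defines "A \<equiv> \<lambda>v w x. (x \<bullet> v) *\<^sub>R w - (x \<bullet> w) *\<^sub>R v"
    and "F1 \<equiv> directional_derivative \<xi> F" and "F2 \<equiv> directional_derivative \<xi> (directional_derivative \<xi> F)"
  shows "(\<Sum>v\<in>E. \<Sum>w\<in>E. directional_derivative (A v w y) (directional_derivative (A v w y) F) y
            + directional_derivative (A v w (A v w y)) F y)
    = 2 * (of_real ((2 * m + real DIM('a) - 4) * (y \<bullet> \<xi>)) * F1 y - F2 y - of_real (m * (m + real DIM('a) - 3)) * F y)"
proof -
  have p: "polynomial_function F" using F by (simp add: harmonic_of_degree_def)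
  note pd = polynomial_directional_derivative
  define B where "B u v = directional_derivative u (directional_derivative v F) y" for u v
  define L where "L u = directional_derivative u F y" for u
  have B1: "linear (\<lambda>v. B v u)" for u
    unfolding B_def by (rule linear_directional_derivative[OF pd[OF p]])
  have comm: "B u v = B v u" for u v
    unfolding B_def by (subst directional_derivative_commute[OF p]) simp
  have B2: "linear (B u)" for u using B1[of u] comm by (metis (no_types, lifting) ext)
  have L: "linear L" unfolding L_def by (rule linear_directional_derivative[OF p])
  interpret B1: linear "\<lambda>v. B v u" for u by (rule B1)
  interpret B2: linear "B u" for u by (rule B2)
  interpret L: linear L by (rule L)
  define a where "a = y \<bullet> \<xi>"
  define z where "z = (\<Sum>v\<in>E. (y \<bullet> v) *\<^sub>R v)"
  have z: "z = y - a *\<^sub>R \<xi>" using expand[of y] E(1,2) by (simp add: z_def a_def algebra_simps)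
  have Ly: "L y = of_real m * F y" using F by (simp add: L_def harmonic_of_degree_def)
  have L\<xi>: "L \<xi> = F1 y" by (simp add: L_def F1_def)
  have By: "B u y = of_real (m - 1) * L u" for u
    unfolding B_def L_def by (rule harmonic_euler2[OF F])
  have B\<xi>: "B \<xi> \<xi> = F2 y" by (simp add: B_def F2_def)
  have "(\<Sum>b\<in>Basis. B b b) = 0" using F by (simp add: B_def harmonic_of_degree_def laplacian_def)
  moreover have "(\<Sum>b\<in>Basis. B b b) = (\<Sum>v\<in>insert \<xi> E. B v v)"
    by (rule trace_orthonormal[OF B1 B2 _ E(3) expand]) (use E(1) in auto)
  ultimately have tr: "(\<Sum>v\<in>E. B v v) = - F2 y"
    using E(1,2) B\<xi> by (simp add: add_eq_0_iff2)
  have "y \<bullet> z = (\<Sum>v\<in>E. (y \<bullet> v)\<^sup>2)"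
    by (simp add: z_def inner_sum_right power2_eq_square)
  moreover have "y \<bullet> z = 1 - a\<^sup>2"
    using y by (simp add: z inner_diff_right a_def power2_eq_square norm_eq_1)
  ultimately have zz: "(\<Sum>v\<in>E. (y \<bullet> v)\<^sup>2) = 1 - a\<^sup>2" by simp
  have Lz: "L z = of_real m * F y - of_real a * F1 y"
    unfolding z L.diff L.scaleR Ly L\<xi> by (simp add: scaleR_conv_of_real)
  have Bzz: "B z z = of_real ((m - 1) * m) * F y - 2 * of_real (a * (m - 1)) * F1 y + of_real (a\<^sup>2) * F2 y"
    unfolding z B1.diff B2.diff B1.scaleR B2.scaleR comm[of y \<xi>] By B\<xi> L.diff L.scaleR Ly L\<xi>
    by (simp add: scaleR_conv_of_real algebra_simps power2_eq_square)
  have c: "of_nat (card E) - 1 = complex_of_real (real DIM('a) - 2)"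
    unfolding card using DIM_positive[where 'a = 'a] by (simp add: of_nat_diff)
  have "(\<Sum>v\<in>E. \<Sum>w\<in>E. B (A v w y) (A v w y) + L (A v w (A v w y)))
     = 2 * of_real (\<Sum>v\<in>E. (y \<bullet> v)\<^sup>2) * (\<Sum>w\<in>E. B w w) - 2 * B z z - 2 * (of_nat (card E) - 1) * L z"
    unfolding A_def z_def by (rule sum_rotation_generators[OF L B1 B2 E(1)]) (use E(3) in auto)
  also have "\<dots> = 2 * (of_real ((2 * m + real DIM('a) - 4) * a) * F1 y - F2 y - of_real (m * (m + real DIM('a) - 3)) * F y)"
    unfolding zz tr Bzz Lz c by (simp add: algebra_simps)
  finally show ?thesis by (simp add: B_def L_def a_def)
qed

lemma pole_basis:
  fixes \<xi> :: "'a::euclidean_space"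
  assumes "norm \<xi> = 1"
  obtains E where "finite E" "\<xi> \<notin> E" "\<And>v w. v \<in> insert \<xi> E \<Longrightarrow> w \<in> insert \<xi> E \<Longrightarrow> v \<bullet> w = (if v = w then 1 else 0)"
    "\<And>x. (\<Sum>v\<in>insert \<xi> E. (x \<bullet> v) *\<^sub>R v) = x" "card E = DIM('a) - 1"
proof -
  obtain S where S: "\<xi> \<in> S" "pairwise orthogonal S" "\<And>x. x \<in> S \<Longrightarrow> norm x = 1"
    "independent S" "card S = DIM('a)" "span S = UNIV"
    using vector_in_orthonormal_basis[OF assms] by metis
  have fin: "finite S" using S(4) by (rule independent_imp_finite)
  have ins: "insert \<xi> (S - {\<xi>}) = S" using S(1) by auto
  show ?thesis
  proof (rule that[of "S - {\<xi>}"], unfold ins)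
    show "v \<bullet> w = (if v = w then 1 else 0)" if "v \<in> S" "w \<in> S" for v w
      using S(2,3) that by (auto simp: norm_eq_1 pairwise_def orthogonal_def)
    show "(\<Sum>v\<in>S. (x \<bullet> v) *\<^sub>R v) = x" for x
    proof -
      have "x \<in> span S" unfolding S(6) by simp
      then show ?thesis by (intro orthonormal_basis_expand[OF S(2)] S(3) fin)
    qed
    show "card (S - {\<xi>}) = DIM('a) - 1" using S(1,5) fin by simp
  qed (use fin in auto)
qed

section \<open>Rotations in a coordinate plane\<close>

text \<open>
  Rotation by the angle \<open>\<theta>\<close> in the plane of the orthonormal vectors \<open>v\<close> and \<open>w\<close>; it fixes the orthogonal
  complement of this plane.
\<close>

definition plane_rotation :: "'a::euclidean_space \<Rightarrow> 'a \<Rightarrow> real \<Rightarrow> 'a \<Rightarrow> 'a" where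
  "plane_rotation v w \<theta> x = x + (cos \<theta> - 1) *\<^sub>R ((x \<bullet> v) *\<^sub>R v + (x \<bullet> w) *\<^sub>R w)
     + sin \<theta> *\<^sub>R ((x \<bullet> v) *\<^sub>R w - (x \<bullet> w) *\<^sub>R v)"

lemma linear_plane_rotation: "linear (plane_rotation v w \<theta>)"
  by (intro linearI) (simp_all add: plane_rotation_def inner_add_left algebra_simps)

lemma orthogonal_plane_rotation:
  fixes v w :: "'a::euclidean_space"
  assumes "norm v = 1" "norm w = 1" "v \<bullet> w = 0"
  shows "orthogonal_transformation (plane_rotation v w \<theta>)"
  unfolding orthogonal_transformation
proof (intro conjI allI linear_plane_rotation)
  fix x :: 'a
  have vw: "v \<bullet> v = 1" "w \<bullet> w = 1" "v \<bullet> w = 0" "w \<bullet> v = 0"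
    using assms by (simp_all add: norm_eq_1 inner_commute)
  define p q u u' where "p = x \<bullet> v" and "q = x \<bullet> w" and "u = p *\<^sub>R v + q *\<^sub>R w" and "u' = p *\<^sub>R w - q *\<^sub>R v"
  have i: "x \<bullet> u = p\<^sup>2 + q\<^sup>2" "x \<bullet> u' = 0" "u \<bullet> u = p\<^sup>2 + q\<^sup>2" "u' \<bullet> u' = p\<^sup>2 + q\<^sup>2" "u \<bullet> u' = 0"
    using vw by (simp_all add: u_def u'_def inner_add_left inner_add_right inner_diff_left inner_diff_right
        p_def[symmetric] q_def[symmetric] power2_eq_square)
  have exp: "(x + c *\<^sub>R u + s *\<^sub>R u') \<bullet> (x + c *\<^sub>R u + s *\<^sub>R u')
    = x \<bullet> x + 2 * c * (x \<bullet> u) + 2 * s * (x \<bullet> u') + c\<^sup>2 * (u \<bullet> u) + 2 * c * s * (u \<bullet> u') + s\<^sup>2 * (u' \<bullet> u')" for c s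
    by (simp add: inner_add_left inner_add_right inner_commute[of u x] inner_commute[of u' x] inner_commute[of u' u]
        algebra_simps power2_eq_square)
  have "plane_rotation v w \<theta> x = x + (cos \<theta> - 1) *\<^sub>R u + sin \<theta> *\<^sub>R u'"
    by (simp add: plane_rotation_def u_def u'_def p_def q_def)
  then have "plane_rotation v w \<theta> x \<bullet> plane_rotation v w \<theta> x
    = x \<bullet> x + 2 * (cos \<theta> - 1) * (x \<bullet> u) + 2 * sin \<theta> * (x \<bullet> u') + (cos \<theta> - 1)\<^sup>2 * (u \<bullet> u)
      + 2 * (cos \<theta> - 1) * sin \<theta> * (u \<bullet> u') + (sin \<theta>)\<^sup>2 * (u' \<bullet> u')"
    by (simp only: exp)
  also have "\<dots> = x \<bullet> x + (p\<^sup>2 + q\<^sup>2) * ((sin \<theta>)\<^sup>2 + (cos \<theta>)\<^sup>2 - 1)"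
  proof -
    have "X + 2 * (c - 1) * P + 2 * s * 0 + (c - 1)\<^sup>2 * P + 2 * (c - 1) * s * 0 + s\<^sup>2 * P = X + P * (s\<^sup>2 + c\<^sup>2 - 1)"
      for X P c s :: real by (simp add: algebra_simps power2_eq_square)
    then show ?thesis unfolding i .
  qed
  also have "\<dots> = x \<bullet> x" by (simp only: sin_cos_squared_add) simp
  finally show "norm (plane_rotation v w \<theta> x) = norm x" by (simp add: norm_eq_sqrt_inner)
qed

lemma plane_rotation_deriv:
  "((\<lambda>\<theta>. plane_rotation v w \<theta> x) has_vector_derivative
     (- sin \<theta>) *\<^sub>R ((x \<bullet> v) *\<^sub>R v + (x \<bullet> w) *\<^sub>R w) + cos \<theta> *\<^sub>R ((x \<bullet> v) *\<^sub>R w - (x \<bullet> w) *\<^sub>R v)) (at \<theta>)"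
  unfolding plane_rotation_def by (auto intro!: derivative_eq_intros)

section \<open>Integrals over the slices of the sphere\<close>

text \<open>
  A unit vector \<open>\<xi>\<close>, taken as the north pole of the sphere; \<open>\<sigma>\<close> is the surface measure of the
  equator.
\<close>

locale pole =
  fixes \<xi> :: "'a::euclidean_space"
  assumes norm_pole: "norm \<xi> = 1" and dim_ge_2: "DIM('a) \<ge> 2"
begin

abbreviation \<sigma> :: "'a measure" where "\<sigma> \<equiv> subsphere_measure \<xi> 0"

sublocale finite_measure \<sigma>
  by (rule measure_equator(1)[OF norm_pole dim_ge_2])

lemma borel_measurable_polynomial:
  fixes F :: "'a \<Rightarrow> complex"
  shows "polynomial_function F \<Longrightarrow> F \<in> borel_measurable borel"
  by (intro borel_measurable_continuous_onI continuous_on_polymonial_function)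

lemma norm_pole_combination_le:
  "norm \<omega> = 1 \<Longrightarrow> norm (a *\<^sub>R \<xi> + b *\<^sub>R \<omega>) \<le> \<bar>a\<bar> + \<bar>b\<bar>"
  by (rule order_trans[OF norm_triangle_ineq]) (simp add: norm_pole)

lemma measurable_polynomial_slice:
  assumes F: "polynomial_function (F :: 'a \<Rightarrow> complex)"
  shows "(\<lambda>\<omega>. F (a *\<^sub>R \<xi> + b *\<^sub>R \<omega>)) \<in> borel_measurable \<sigma>"
proof -
  note [measurable] = borel_measurable_polynomial[OF F]
  show ?thesis by measurable
qed

lemma integrable_polynomial_slice:
  assumes F: "polynomial_function (F :: 'a \<Rightarrow> complex)"
  shows "integrable \<sigma> (\<lambda>\<omega>. F (a *\<^sub>R \<xi> + b *\<^sub>R \<omega>))"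
proof -
  have "bounded (F ` cball 0 (\<bar>a\<bar> + \<bar>b\<bar>))"
    by (intro compact_imp_bounded compact_continuous_image continuous_on_polymonial_function F compact_cball)
  then obtain K where "\<forall>x\<in>cball 0 (\<bar>a\<bar> + \<bar>b\<bar>). norm (F x) \<le> K"
    unfolding bounded_iff by blast
  then have K: "norm (F (a *\<^sub>R \<xi> + b *\<^sub>R \<omega>)) \<le> K" if "norm \<omega> = 1" for \<omega>
    using norm_pole_combination_le[OF that, of a b] by simp
  show ?thesis
  proof (rule integrable_const_bound)
    show "AE \<omega> in \<sigma>. norm (F (a *\<^sub>R \<xi> + b *\<^sub>R \<omega>)) \<le> K"
      using AE_equator[OF norm_pole dim_ge_2] by eventually_elim (use K in blast)
  qed (rule measurable_polynomial_slice[OF F])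
qed

text \<open>
  Invariance of \<open>\<sigma>\<close> under rotations about \<open>\<xi>\<close>, differentiated at the angle \<open>0\<close>.
\<close>

lemma integral_rotation_generator:
  fixes v w :: 'a and F :: "'a \<Rightarrow> complex"
  assumes F: "polynomial_function F"
    and vw: "norm v = 1" "norm w = 1" "v \<bullet> w = 0" "\<xi> \<bullet> v = 0" "\<xi> \<bullet> w = 0"
  defines "A \<equiv> \<lambda>x. (x \<bullet> v) *\<^sub>R w - (x \<bullet> w) *\<^sub>R v"
  shows "(LINT \<omega>|\<sigma>. directional_derivative (A (a *\<^sub>R \<xi> + b *\<^sub>R \<omega>)) F (a *\<^sub>R \<xi> + b *\<^sub>R \<omega>)) = 0"
proof -
  let ?R = "plane_rotation v w"
  let ?y = "\<lambda>\<omega>. a *\<^sub>R \<xi> + b *\<^sub>R \<omega>"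
  define R' where "R' \<theta> x = (- sin \<theta>) *\<^sub>R ((x \<bullet> v) *\<^sub>R v + (x \<bullet> w) *\<^sub>R w) + cos \<theta> *\<^sub>R A x" for \<theta> x
  have orth: "orthogonal_transformation (?R \<theta>)" for \<theta>
    by (rule orthogonal_plane_rotation[OF vw(1-3)])
  have R\<xi>: "?R \<theta> \<xi> = \<xi>" for \<theta> using vw(4,5) by (simp add: plane_rotation_def)
  have polyR: "polynomial_function (\<lambda>x. F (?R \<theta> x))" for \<theta>
    using polynomial_function_compose[OF polynomial_function_bounded_linear F, of "?R \<theta>"]
      linear_plane_rotation[of v w \<theta>] by (simp add: linear_conv_bounded_linear o_def)
  have linA: "linear A" unfolding A_def by (intro linearI) (simp_all add: inner_add_left algebra_simps)
  \<comment> \<open>The rotation fixes \<open>\<xi>\<close>, so it can be moved to \<open>\<omega>\<close>, where \<open>\<sigma>\<close> absorbs it.\<close>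
  have const: "(LINT \<omega>|\<sigma>. F (?R \<theta> (?y \<omega>))) = (LINT \<omega>|\<sigma>. F (?y \<omega>))" for \<theta>
  proof -
    note [measurable] = orthogonal_transformation_imp_borel[OF orth[of \<theta>]] borel_measurable_polynomial[OF F]
    have "?R \<theta> (?y \<omega>) = ?y (?R \<theta> \<omega>)" for \<omega>
      using linear_plane_rotation[of v w \<theta>] R\<xi>[of \<theta>] by (simp add: linear_add linear_scale)
    then have "(LINT \<omega>|\<sigma>. F (?R \<theta> (?y \<omega>))) = (LINT \<omega>|distr \<sigma> borel (?R \<theta>). F (?y \<omega>))"
      by (subst integral_distr) auto
    then show ?thesis by (simp only: distr_equator[OF norm_pole orth R\<xi>])
  qed
  obtain K where K: "K \<ge> 0" "\<And>x u. norm x \<le> \<bar>a\<bar> + \<bar>b\<bar> \<Longrightarrow> norm (directional_derivative u F x) \<le> K * norm u"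
    using directional_derivative_bound[OF F] by metis
  have "((\<lambda>\<theta>. LINT \<omega>|\<sigma>. F (?R \<theta> (?y \<omega>))) has_vector_derivative
      (LINT \<omega>|\<sigma>. directional_derivative (R' 0 (?y \<omega>)) F (?R 0 (?y \<omega>)))) (at 0)"
  proof (rule has_vector_derivative_integral[where e = 1 and C = "K * (4 * (\<bar>a\<bar> + \<bar>b\<bar>))"])
    show "finite_measure \<sigma>" by (rule measure_equator(1)[OF norm_pole dim_ge_2])
    show "integrable \<sigma> (\<lambda>\<omega>. F (?R \<theta> (?y \<omega>)))" for \<theta>
      by (rule integrable_polynomial_slice[OF polyR])
    show "(\<lambda>\<omega>. directional_derivative (R' 0 (?y \<omega>)) F (?R 0 (?y \<omega>))) \<in> borel_measurable \<sigma>"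
      using measurable_polynomial_slice[OF directional_derivative_along(1)[OF F linA], of a b]
      by (simp add: R'_def plane_rotation_def)
    show "((\<lambda>\<theta>. F (?R \<theta> (?y \<omega>))) has_vector_derivative directional_derivative (R' \<theta> (?y \<omega>)) F (?R \<theta> (?y \<omega>))) (at \<theta>)" for \<theta> \<omega>
      unfolding R'_def A_def by (rule polynomial_chain_rule[OF F plane_rotation_deriv])
    show "AE \<omega> in \<sigma>. \<forall>\<theta>\<in>ball 0 1. norm (directional_derivative (R' \<theta> (?y \<omega>)) F (?R \<theta> (?y \<omega>))) \<le> K * (4 * (\<bar>a\<bar> + \<bar>b\<bar>))"
      using AE_equator[OF norm_pole dim_ge_2]
    proof (eventually_elim, intro ballI)
      fix \<omega> \<theta> assume "norm \<omega> = 1 \<and> \<xi> \<bullet> \<omega> = 0"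
      then have y: "norm (?y \<omega>) \<le> \<bar>a\<bar> + \<bar>b\<bar>"
        by (intro norm_pole_combination_le) simp
      have "norm (?R \<theta> (?y \<omega>)) \<le> \<bar>a\<bar> + \<bar>b\<bar>"
        using y orthogonal_transformation_norm[OF orth[of \<theta>], of "?y \<omega>"] by simp
      then have "norm (directional_derivative (R' \<theta> (?y \<omega>)) F (?R \<theta> (?y \<omega>))) \<le> K * norm (R' \<theta> (?y \<omega>))"
        by (rule K(2))
      also have "norm (R' \<theta> (?y \<omega>)) \<le> 4 * norm (?y \<omega>)"
      proof -
        let ?p = "?y \<omega> \<bullet> v" and ?q = "?y \<omega> \<bullet> w"
        have pq: "\<bar>?p\<bar> \<le> norm (?y \<omega>)" "\<bar>?q\<bar> \<le> norm (?y \<omega>)"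
          using Cauchy_Schwarz_ineq2[of "?y \<omega>"] vw(1,2) by (metis mult.right_neutral)+
        have "norm (?p *\<^sub>R v + ?q *\<^sub>R w) \<le> \<bar>?p\<bar> + \<bar>?q\<bar>" "norm (?p *\<^sub>R w - ?q *\<^sub>R v) \<le> \<bar>?p\<bar> + \<bar>?q\<bar>"
          using norm_triangle_ineq[of "?p *\<^sub>R v" "?q *\<^sub>R w"] norm_triangle_ineq4[of "?p *\<^sub>R w" "?q *\<^sub>R v"] vw(1,2)
            by simp_all
        then have n: "norm (?p *\<^sub>R v + ?q *\<^sub>R w) \<le> 2 * norm (?y \<omega>)" "norm (A (?y \<omega>)) \<le> 2 * norm (?y \<omega>)"
          using pq unfolding A_def by linarith+
        have c: "\<bar>c\<bar> * x \<le> B" if "\<bar>c\<bar> \<le> 1" "x \<le> B" "0 \<le> x" for c x B :: real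
          using mult_right_mono[of "\<bar>c\<bar>" 1 x] that by linarith
        have "norm (R' \<theta> (?y \<omega>)) \<le> \<bar>- sin \<theta>\<bar> * norm (?p *\<^sub>R v + ?q *\<^sub>R w) + \<bar>cos \<theta>\<bar> * norm (A (?y \<omega>))"
          unfolding R'_def by (rule order_trans[OF norm_triangle_ineq]) simp
        also have "\<dots> \<le> 2 * norm (?y \<omega>) + 2 * norm (?y \<omega>)"
          using n by (intro add_mono c) (simp_all add: abs_sin_le_one abs_cos_le_one)
        finally show ?thesis by simp
      qed
      finally show "norm (directional_derivative (R' \<theta> (?y \<omega>)) F (?R \<theta> (?y \<omega>))) \<le> K * (4 * (\<bar>a\<bar> + \<bar>b\<bar>))"
        using y K(1) by (simp add: mult_left_mono order_trans)
    qed
  qed simp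
  then have "((\<lambda>\<theta>::real. LINT \<omega>|\<sigma>. F (?y \<omega>)) has_vector_derivative
      (LINT \<omega>|\<sigma>. directional_derivative (A (?y \<omega>)) F (?y \<omega>))) (at 0)"
    by (simp only: const) (simp add: R'_def plane_rotation_def)
  then show ?thesis using vector_derivative_unique_at[OF _ has_vector_derivative_const] by blast
qed

text \<open>
  The left-hand side of \<open>harmonic_rotation_identity\<close> integrates to zero, because each of its terms is the
  derivative along a rotation generator of the polynomial that arises from \<open>F\<close> in the same way.  The condition on
  \<open>a\<close> and \<open>b\<close> places the points of integration on the unit sphere.
\<close>

lemma integral_gegenbauer:
  fixes F :: "'a \<Rightarrow> complex"
  assumes F: "harmonic_of_degree m F" and ab: "a\<^sup>2 + b\<^sup>2 = 1"
  defines "J \<equiv> \<lambda>G. LINT \<omega>|\<sigma>. G (a *\<^sub>R \<xi> + b *\<^sub>R \<omega>)"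
  shows "J (directional_derivative \<xi> (directional_derivative \<xi> F))
    = of_real ((2 * m + real DIM('a) - 4) * a) * J (directional_derivative \<xi> F) - of_real (m * (m + real DIM('a) - 3)) * J F"
proof -
  have p: "polynomial_function F" using F by (simp add: harmonic_of_degree_def)
  note pd = polynomial_directional_derivative
  obtain E where E: "finite E" "\<xi> \<notin> E" "\<And>v w. v \<in> insert \<xi> E \<Longrightarrow> w \<in> insert \<xi> E \<Longrightarrow> v \<bullet> w = (if v = w then 1 else 0)"
    "\<And>x. (\<Sum>v\<in>insert \<xi> E. (x \<bullet> v) *\<^sub>R v) = x" "card E = DIM('a) - 1"
    using pole_basis[OF norm_pole] by metis
  define A where "A v w x = (x \<bullet> v) *\<^sub>R w - (x \<bullet> w) *\<^sub>R v" for v w x :: 'a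
  let ?y = "\<lambda>\<omega>. a *\<^sub>R \<xi> + b *\<^sub>R \<omega>"
  define F1 where "F1 = directional_derivative \<xi> F"
  define F2 where "F2 = directional_derivative \<xi> F1"
  have linA: "linear (A v w)" for v w
    unfolding A_def by (intro linearI) (simp_all add: inner_add_left algebra_simps)
  define F' where "F' v w x = directional_derivative (A v w x) F x" for v w x
  have pF': "polynomial_function (F' v w)" for v w
    unfolding F'_def[abs_def] by (rule directional_derivative_along(1)[OF p linA])
  have dF': "directional_derivative (A v w x) (F' v w) x
      = directional_derivative (A v w x) (directional_derivative (A v w x) F) x
            + directional_derivative (A v w (A v w x)) F x" for v w x
    unfolding F'_def[abs_def] by (rule directional_derivative_along(2)[OF p linA])
  have int: "integrable \<sigma> (\<lambda>\<omega>. directional_derivative (A v w (?y \<omega>)) (F' v w) (?y \<omega>))" for v w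
    by (rule integrable_polynomial_slice[OF directional_derivative_along(1)[OF pF' linA]])
  have zero: "(LINT \<omega>|\<sigma>. directional_derivative (A v w (?y \<omega>)) (F' v w) (?y \<omega>)) = 0" if "v \<in> E" "w \<in> E" for v w
  proof (cases "v = w")
    case True
    have "directional_derivative 0 (F' v w) x = 0" for x
      using linear_0[OF linear_directional_derivative[OF pF']] by simp
    then show ?thesis using True by (simp add: A_def)
  next
    case False
    have "\<xi> \<noteq> v" "\<xi> \<noteq> w" using that E(2) by auto
    then have "norm v = 1" "norm w = 1" "v \<bullet> w = 0" "\<xi> \<bullet> v = 0" "\<xi> \<bullet> w = 0"
      using E(3) that False by (auto simp: norm_eq_1)
    from integral_rotation_generator[OF pF'[of v w] this, of a b] show ?thesis
      by (simp add: A_def)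
  qed
  have "0 = (\<Sum>v\<in>E. \<Sum>w\<in>E. (LINT \<omega>|\<sigma>. directional_derivative (A v w (?y \<omega>)) (F' v w) (?y \<omega>)))"
    by (simp add: zero)
  also have "\<dots> = (LINT \<omega>|\<sigma>. (\<Sum>v\<in>E. \<Sum>w\<in>E. directional_derivative (A v w (?y \<omega>)) (F' v w) (?y \<omega>)))"
    using int by (simp add: Bochner_Integration.integral_sum Bochner_Integration.integrable_sum)
  also have "\<dots> = (LINT \<omega>|\<sigma>. 2 * (of_real ((2 * m + real DIM('a) - 4) * a) * F1 (?y \<omega>) - F2 (?y \<omega>)
     - of_real (m * (m + real DIM('a) - 3)) * F (?y \<omega>)))"
  proof (rule integral_cong_AE)
    show "AE \<omega> in \<sigma>. (\<Sum>v\<in>E. \<Sum>w\<in>E. directional_derivative (A v w (?y \<omega>)) (F' v w) (?y \<omega>))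
      = 2 * (of_real ((2 * m + real DIM('a) - 4) * a) * F1 (?y \<omega>) - F2 (?y \<omega>)
           - of_real (m * (m + real DIM('a) - 3)) * F (?y \<omega>))"
      using AE_equator[OF norm_pole dim_ge_2]
    proof eventually_elim
      fix \<omega> assume \<omega>: "norm \<omega> = 1 \<and> \<xi> \<bullet> \<omega> = 0"
      have a: "?y \<omega> \<bullet> \<xi> = a"
        using \<omega> norm_pole by (simp add: inner_add_left inner_commute[of \<omega> \<xi>] norm_eq_1)
      have "?y \<omega> \<bullet> ?y \<omega> = a\<^sup>2 + b\<^sup>2"
        using \<omega> norm_pole
          by (simp add: inner_add_left inner_add_right inner_commute[of \<omega> \<xi>] norm_eq_1 power2_eq_square)
      then have "norm (?y \<omega>) = 1" using ab by (simp add: norm_eq_1)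
      from harmonic_rotation_identity[OF F E this] show
        "(\<Sum>v\<in>E. \<Sum>w\<in>E. directional_derivative (A v w (?y \<omega>)) (F' v w) (?y \<omega>))
          = 2 * (of_real ((2 * m + real DIM('a) - 4) * a) * F1 (?y \<omega>) - F2 (?y \<omega>)
           - of_real (m * (m + real DIM('a) - 3)) * F (?y \<omega>))"
        unfolding dF' a F2_def F1_def unfolding A_def .
    qed
    show "(\<lambda>\<omega>. \<Sum>v\<in>E. \<Sum>w\<in>E. directional_derivative (A v w (?y \<omega>)) (F' v w) (?y \<omega>)) \<in> borel_measurable \<sigma>"
      by (intro borel_measurable_sum borel_measurable_integrable[OF int])
    show "(\<lambda>\<omega>. 2 * (of_real ((2 * m + real DIM('a) - 4) * a) * F1 (?y \<omega>) - F2 (?y \<omega>)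
           - of_real (m * (m + real DIM('a) - 3)) * F (?y \<omega>))) \<in> borel_measurable \<sigma>"
      unfolding F1_def F2_def
      by (intro borel_measurable_times borel_measurable_diff borel_measurable_const measurable_polynomial_slice p pd)
  qed
  also have "\<dots> = 2 * (of_real ((2 * m + real DIM('a) - 4) * a) * J F1 - J F2
     - of_real (m * (m + real DIM('a) - 3)) * J F)"
  proof -
    have "(LINT \<omega>|\<sigma>. 2 * (c1 * f1 \<omega> - f2 \<omega> - c0 * f0 \<omega>)) = 2 * (c1 * integral\<^sup>L \<sigma> f1 - integral\<^sup>L \<sigma> f2 - c0 * integral\<^sup>L \<sigma> f0)"
      if "integrable \<sigma> f0" "integrable \<sigma> f1" "integrable \<sigma> f2" for c0 c1 :: complex and f0 f1 f2 :: "'a \<Rightarrow> complex"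
      using that by simp
    then show ?thesis unfolding J_def F1_def F2_def by (simp only: integrable_polynomial_slice p pd)
  qed
  finally have "of_real ((2 * m + real DIM('a) - 4) * a) * J F1 - J F2 - of_real (m * (m + real DIM('a) - 3)) * J F = 0"
    by (metis mult_eq_0_iff zero_neq_numeral)
  moreover have "x - y - z = 0 \<Longrightarrow> y = x - z" for x y z :: complex by algebra
  ultimately show ?thesis unfolding F1_def F2_def by blast
qed

text \<open>
  The integral of \<open>F\<close> over the slice of the unit sphere at height \<open>t\<close>, taken with respect to the surface
  measure of the equator.
\<close>

definition slice_integral :: "('a \<Rightarrow> complex) \<Rightarrow> real \<Rightarrow> complex" where
  "slice_integral F t = (LINT \<omega>|\<sigma>. F (t *\<^sub>R \<xi> + sqrt (1 - t\<^sup>2) *\<^sub>R \<omega>))"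

lemma slice_integral_gegenbauer:
  assumes F: "harmonic_of_degree m F" and t: "\<bar>t\<bar> < 1"
  shows "slice_integral (directional_derivative \<xi> (directional_derivative \<xi> F)) t
    = of_real ((2 * m + real DIM('a) - 4) * t) * slice_integral (directional_derivative \<xi> F) t
      - of_real (m * (m + real DIM('a) - 3)) * slice_integral F t"
proof -
  have "t\<^sup>2 < 1" using t by (simp add: abs_square_less_1)
  then show ?thesis unfolding slice_integral_def by (intro integral_gegenbauer[OF F]) simp
qed

lemma slice_integral_deriv:
  assumes F: "harmonic_of_degree m F" and t: "\<bar>t\<bar> < 1"
  shows "(slice_integral F has_vector_derivative
    (slice_integral (directional_derivative \<xi> F) t - of_real (m * t) * slice_integral F t) / of_real (1 - t\<^sup>2)) (at t)"
proof -
  have p: "polynomial_function F" using F by (simp add: harmonic_of_degree_def)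
  define F1 where "F1 = directional_derivative \<xi> F"
  have p1: "polynomial_function F1" unfolding F1_def by (rule polynomial_directional_derivative[OF p])
  define y where "y t \<omega> = t *\<^sub>R \<xi> + sqrt (1 - t\<^sup>2) *\<^sub>R \<omega>" for t \<omega>
  define y' where "y' t \<omega> = \<xi> - (t / sqrt (1 - t\<^sup>2)) *\<^sub>R \<omega>" for t \<omega>
  have pos: "1 - t\<^sup>2 > 0" if "\<bar>t\<bar> < 1" for t :: real using that by (simp add: abs_square_less_1)
  define q where "q = (1 + \<bar>t\<bar>) / 2"
  have q: "\<bar>t\<bar> < q" "q < 1" "0 < q" using t by (auto simp: q_def)
  have ball: "\<bar>s\<bar> < q" if "s \<in> ball t (q - \<bar>t\<bar>)" for s
    using that by (auto simp: dist_real_def)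
  \<comment> \<open>A bound for the velocity \<open>y'\<close>, valid for all heights up to \<open>q\<close>.\<close>
  define C where "C = 1 + 1 / sqrt (1 - q\<^sup>2)"
  have dy: "((\<lambda>t. y t \<omega>) has_vector_derivative y' s \<omega>) (at s)" if "\<bar>s\<bar> < 1" for s \<omega>
    unfolding y_def y'_def using pos[OF that]
    by (auto intro!: derivative_eq_intros simp: divide_simps)
  obtain K where K: "K \<ge> 0" "\<And>x u. norm x \<le> 2 \<Longrightarrow> norm (directional_derivative u F x) \<le> K * norm u"
    using directional_derivative_bound[OF p] by metis
  have alt: "directional_derivative (y' s \<omega>) F (y s \<omega>) = (F1 (y s \<omega>) - of_real (m * s) * F (y s \<omega>)) / of_real (1 - s\<^sup>2)"
    if s: "\<bar>s\<bar> < 1" for s \<omega>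
  proof -
    interpret D: linear "\<lambda>v. directional_derivative v F (y s \<omega>)"
      by (rule linear_directional_derivative[OF p])
    have "(1 - s\<^sup>2) *\<^sub>R y' s \<omega> = \<xi> - s *\<^sub>R y s \<omega>"
    proof -
      have "(1 - s\<^sup>2) * (s / sqrt (1 - s\<^sup>2)) = s * sqrt (1 - s\<^sup>2)"
        using pos[OF s] by (simp add: real_div_sqrt field_simps)
      then show ?thesis by (simp add: y'_def y_def algebra_simps power2_eq_square)
    qed
    then have "(1 - s\<^sup>2) *\<^sub>R directional_derivative (y' s \<omega>) F (y s \<omega>) = F1 (y s \<omega>) - s *\<^sub>R (of_real m * F (y s \<omega>))"
      using F unfolding D.scaleR[symmetric] by (simp add: D.diff D.scaleR F1_def harmonic_of_degree_def)
    then have eq: "directional_derivative (y' s \<omega>) F (y s \<omega>) * of_real (1 - s\<^sup>2) = F1 (y s \<omega>) - of_real (m * s) * F (y s \<omega>)"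
      by (simp add: scaleR_conv_of_real algebra_simps)
    have "complex_of_real (1 - s\<^sup>2) \<noteq> 0" using pos[OF s] by (simp only: of_real_eq_0_iff)
    then show ?thesis by (rule eq_divide_imp[OF _ eq])
  qed
  have "((\<lambda>t. LINT \<omega>|\<sigma>. F (y t \<omega>)) has_vector_derivative (LINT \<omega>|\<sigma>. directional_derivative (y' t \<omega>) F (y t \<omega>))) (at t)"
  proof (rule has_vector_derivative_integral[where e = "q - \<bar>t\<bar>" and C = "K * C"])
    show "finite_measure \<sigma>" by (rule measure_equator(1)[OF norm_pole dim_ge_2])
    show "integrable \<sigma> (\<lambda>\<omega>. F (y s \<omega>))" for s
      unfolding y_def by (rule integrable_polynomial_slice[OF p])
    show "(\<lambda>\<omega>. directional_derivative (y' t \<omega>) F (y t \<omega>)) \<in> borel_measurable \<sigma>"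
      unfolding alt[OF t] unfolding y_def
      by (intro borel_measurable_divide borel_measurable_diff borel_measurable_times measurable_polynomial_slice p p1) auto
    show "((\<lambda>t. F (y t \<omega>)) has_vector_derivative directional_derivative (y' s \<omega>) F (y s \<omega>)) (at s)"
      if "s \<in> ball t (q - \<bar>t\<bar>)" for s \<omega>
      by (rule polynomial_chain_rule[OF p dy]) (use ball[OF that] q in simp)
    show "AE \<omega> in \<sigma>. \<forall>s\<in>ball t (q - \<bar>t\<bar>). norm (directional_derivative (y' s \<omega>) F (y s \<omega>)) \<le> K * C"
      using AE_equator[OF norm_pole dim_ge_2]
    proof (eventually_elim, intro ballI)
      fix \<omega> s assume \<omega>: "norm \<omega> = 1 \<and> \<xi> \<bullet> \<omega> = 0" and "s \<in> ball t (q - \<bar>t\<bar>)"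
      then have s: "\<bar>s\<bar> < q" by (intro ball)
      then have "s\<^sup>2 \<le> q\<^sup>2" by (metis abs_le_square_iff abs_of_pos less_imp_le q(3))
      then have le: "sqrt (1 - q\<^sup>2) \<le> sqrt (1 - s\<^sup>2)" by simp
      have q0: "sqrt (1 - q\<^sup>2) > 0" using pos[of q] q by simp
      have "norm (y s \<omega>) \<le> \<bar>s\<bar> + \<bar>sqrt (1 - s\<^sup>2)\<bar>"
        unfolding y_def using \<omega> by (intro norm_pole_combination_le) simp
      also have "\<bar>sqrt (1 - s\<^sup>2)\<bar> \<le> 1" using pos[of s] s q by simp
      finally have "norm (y s \<omega>) \<le> 2" using s q by linarith
      then have "norm (directional_derivative (y' s \<omega>) F (y s \<omega>)) \<le> K * norm (y' s \<omega>)"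
        by (rule K(2))
      also have "norm (y' s \<omega>) \<le> C"
      proof -
        have "norm (y' s \<omega>) \<le> 1 + \<bar>s / sqrt (1 - s\<^sup>2)\<bar>"
          unfolding y'_def by (rule order_trans[OF norm_triangle_ineq4]) (simp add: norm_pole \<omega>)
        also have "\<bar>s / sqrt (1 - s\<^sup>2)\<bar> \<le> 1 / sqrt (1 - q\<^sup>2)"
          unfolding abs_divide using s q q0 le by (intro frac_le) auto
        finally show ?thesis by (simp add: C_def)
      qed
      finally show "norm (directional_derivative (y' s \<omega>) F (y s \<omega>)) \<le> K * C"
        using K(1) by (simp add: mult_left_mono)
    qed
  qed (use q in simp)
  moreover have "(LINT \<omega>|\<sigma>. directional_derivative (y' t \<omega>) F (y t \<omega>))
     = (slice_integral F1 t - of_real (m * t) * slice_integral F t) / of_real (1 - t\<^sup>2)"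
    unfolding alt[OF t] slice_integral_def unfolding y_def
    by (simp add: integrable_polynomial_slice p p1)
  ultimately show ?thesis
    by (simp add: slice_integral_def[abs_def] F1_def y_def)
qed

end

section \<open>Iterated derivatives of solutions of the differential equation\<close>

lemma iterated_vector_derivative_eq:
  fixes h :: "nat \<Rightarrow> real \<Rightarrow> 'b::real_normed_vector"
  assumes S: "open S" and g: "\<And>t. t \<in> S \<Longrightarrow> g t = h 0 t"
    and h: "\<And>j t. t \<in> S \<Longrightarrow> (h j has_vector_derivative h (Suc j) t) (at t)"
    and t: "t \<in> S"
  shows "nth_vector_derivative j g t = h j t"
  using t
proof (induction j arbitrary: t)
  case 0
  then show ?case by (simp add: nth_vector_derivative_def g)
next
  case (Suc j)
  have "(nth_vector_derivative j g has_vector_derivative h (Suc j) t) (at t)"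
    by (rule has_vector_derivative_transform_within_open[OF h[OF Suc.prems, of j] S Suc.prems]) (simp add: Suc.IH)
  then have "vector_derivative (nth_vector_derivative j g) (at t) = h (Suc j) t" by (rule vector_derivative_at)
  then show ?case by (simp add: nth_vector_derivative_def)
qed

text \<open>
  The derivatives of a solution \<open>g0\<close> of \<open>(1 - t\<^sup>2) g0'' + c t g0' + k g0 = 0\<close> with \<open>g0' = g1\<close>,
  expressed through \<open>g0\<close> and \<open>g1\<close> by solving the \<open>j\<close>-fold differentiated equation for the highest derivative.
\<close>

fun legendre_derivs :: "real \<Rightarrow> real \<Rightarrow> (real \<Rightarrow> complex) \<Rightarrow> (real \<Rightarrow> complex) \<Rightarrow> nat \<Rightarrow> real \<Rightarrow> complex" where
  "legendre_derivs c k g0 g1 0 = g0"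
| "legendre_derivs c k g0 g1 (Suc 0) = g1"
| "legendre_derivs c k g0 g1 (Suc (Suc j)) = (\<lambda>t.
     (- 1 / (1 - t\<^sup>2)) *\<^sub>R (((c - 2 * real j) * t) *\<^sub>R legendre_derivs c k g0 g1 (Suc j) t
        + (k + c * real j - real j * (real j - 1)) *\<^sub>R legendre_derivs c k g0 g1 j t))"

lemma legendre_derivs_deriv:
  assumes g0: "\<And>t. \<bar>t\<bar> < 1 \<Longrightarrow> (g0 has_vector_derivative g1 t) (at t)"
    and g1: "\<And>t. \<bar>t\<bar> < 1 \<Longrightarrow> (g1 has_vector_derivative (- 1 / (1 - t\<^sup>2)) *\<^sub>R ((c * t) *\<^sub>R g1 t + k *\<^sub>R g0 t)) (at t)"
    and t: "\<bar>t\<bar> < 1"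
  shows "(legendre_derivs c k g0 g1 j has_vector_derivative legendre_derivs c k g0 g1 (Suc j) t) (at t)"
  using t
proof (induction j arbitrary: t rule: less_induct)
  case (less j)
  let ?h = "legendre_derivs c k g0 g1"
  consider "j = 0" | "j = 1" | i where "j = Suc (Suc i)" by (metis One_nat_def not0_implies_Suc)
  then show ?case
  proof cases
    case 1
    then show ?thesis using g0[OF less.prems] by simp
  next
    case 2
    then show ?thesis using g1[OF less.prems] by simp
  next
    case (3 i)
    have p: "1 - t\<^sup>2 > 0" using less.prems by (simp add: abs_square_less_1)
    have d0: "(?h i has_vector_derivative ?h (Suc i) t) (at t)"
      and d1: "(?h (Suc i) has_vector_derivative ?h (Suc (Suc i)) t) (at t)"
      using less.IH[of i t] less.IH[of "Suc i" t] less.prems 3 by auto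
    define a where "a = c - 2 * real i"
    define b where "b = k + c * real i - real i * (real i - 1)"
    define N where "N s = (a * s) *\<^sub>R ?h (Suc i) s + b *\<^sub>R ?h i s" for s
    define N' where "N' = (a * t) *\<^sub>R ?h (Suc (Suc i)) t + a *\<^sub>R ?h (Suc i) t + b *\<^sub>R ?h (Suc i) t"
    have h2: "?h (Suc (Suc i)) = (\<lambda>s. (- 1 / (1 - s\<^sup>2)) *\<^sub>R N s)"
      by (simp add: N_def a_def b_def)
    have "(N has_vector_derivative N') (at t)"
      unfolding N_def[abs_def] N'_def
      by (rule has_vector_derivative_eq_rhs, rule has_vector_derivative_add, rule has_vector_derivative_scaleR[OF _ d1],
          auto intro!: derivative_eq_intros d0)
    moreover have "((\<lambda>s. - 1 / (1 - s\<^sup>2)) has_field_derivative - 2 * t / (1 - t\<^sup>2)\<^sup>2) (at t)"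
      using p by (auto intro!: derivative_eq_intros simp: power2_eq_square)
    ultimately have "((\<lambda>s. (- 1 / (1 - s\<^sup>2)) *\<^sub>R N s) has_vector_derivative
      (- 1 / (1 - t\<^sup>2)) *\<^sub>R N' + (- 2 * t / (1 - t\<^sup>2)\<^sup>2) *\<^sub>R N t) (at t)"
      by (intro has_vector_derivative_scaleR)
    moreover have "(- 1 / (1 - t\<^sup>2)) *\<^sub>R N' + (- 2 * t / (1 - t\<^sup>2)\<^sup>2) *\<^sub>R N t = ?h (Suc (Suc (Suc i))) t"
    proof -
      have "(- 2 * t / (1 - t\<^sup>2)\<^sup>2) *\<^sub>R N t = (- 1 / (1 - t\<^sup>2)) *\<^sub>R (- (2 * t) *\<^sub>R ?h (Suc (Suc i)) t)"
        unfolding h2 by (simp add: power2_eq_square)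
      moreover have "?h (Suc (Suc (Suc i))) t
         = (- 1 / (1 - t\<^sup>2)) *\<^sub>R (((a - 2) * t) *\<^sub>R ?h (Suc (Suc i)) t + (b + a) *\<^sub>R ?h (Suc i) t)"
        by (subst legendre_derivs.simps(3)) (simp add: a_def b_def algebra_simps del: legendre_derivs.simps)
      ultimately show ?thesis
        unfolding N'_def
          by (simp only: scaleR_add_right[symmetric]) (simp add: algebra_simps del: legendre_derivs.simps)
    qed
    ultimately show ?thesis unfolding 3 by (subst h2) simp
  qed
qed

section \<open>Spherical harmonics as eigenfunctions\<close>

context pole
begin

text \<open>
  Induction on the degree, in steps of two: at height \<open>0\<close>, \<open>slice_integral_gegenbauer\<close> expresses the integral
  of \<open>F\<close> by that of its second derivative in direction \<open>\<xi>\<close>.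
\<close>

lemma slice_integral_0:
  assumes dim: "DIM('a) \<ge> 3" and "harmonic_of_degree (real n) F"
  shows "slice_integral F 0 = of_real (sphere_area (DIM('a) - 1) * legendre_at_0 (DIM('a) - 3) n) * F \<xi>"
  using assms(2)
proof (induction "DIM('a) - 3" n arbitrary: F rule: legendre_at_0.induct)
  case (1 F)
  then have "F x = F \<xi>" for x by (intro harmonic_of_degree_0) simp
  then have "slice_integral F 0 = (LINT \<omega>|\<sigma>. F \<xi>)" unfolding slice_integral_def
    by (metis (no_types))
  also have "\<dots> = measure \<sigma> UNIV *\<^sub>R F \<xi>" by simp
  finally show ?case by (simp add: measure_equator(2)[OF norm_pole dim_ge_2] scaleR_conv_of_real)
next
  case (2 F)
  have "harmonic_of_degree (- 1) (directional_derivative \<xi> (directional_derivative \<xi> F))"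
    using harmonic_directional_derivative[OF harmonic_directional_derivative[OF 2(1)], of \<xi> \<xi>] by simp
  from harmonic_of_degree_minus_1[OF this]
  have "slice_integral (directional_derivative \<xi> (directional_derivative \<xi> F)) 0 = 0"
    by (simp add: slice_integral_def)
  with slice_integral_gegenbauer[OF 2(1), of 0] have "of_real (real DIM('a) - 2) * slice_integral F 0 = 0"
    by simp
  moreover have "complex_of_real (real DIM('a) - 2) \<noteq> 0" using dim by (simp only: of_real_eq_0_iff)
  ultimately show ?case by simp
next
  case (3 n F)
  define F1 where "F1 = directional_derivative \<xi> F"
  define F2 where "F2 = directional_derivative \<xi> F1"
  define e where "e = real (DIM('a) - 3)"
  have e: "real DIM('a) = e + 3" using dim by (simp add: e_def of_nat_diff)
  have h1: "harmonic_of_degree (real n + 1) F1"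
    using harmonic_directional_derivative[OF 3(2), of \<xi>] by (simp add: F1_def add.commute)
  have h2: "harmonic_of_degree (real n) F2"
    using harmonic_directional_derivative[OF h1, of \<xi>] by (simp add: F2_def)
  have "F1 \<xi> = of_real (real n + 2) * F \<xi>" using 3(2) by (simp add: F1_def harmonic_of_degree_def)
  moreover have "F2 \<xi> = of_real (real n + 1) * F1 \<xi>" using h1 by (simp add: F2_def harmonic_of_degree_def)
  ultimately have F2\<xi>: "F2 \<xi> = of_real ((real n + 1) * (real n + 2)) * F \<xi>" by simp
  have "slice_integral F2 0 = - of_real ((real n + 2) * (real n + 2 + e)) * slice_integral F 0"
    using slice_integral_gegenbauer[OF 3(2), of 0] by (simp add: F1_def F2_def e algebra_simps)
  moreover have "complex_of_real ((real n + 2) * (real n + 2 + e)) \<noteq> 0"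
    unfolding of_real_eq_0_iff e_def by (simp add: add_nonneg_eq_0_iff)
  ultimately have "slice_integral F 0 = - slice_integral F2 0 / of_real ((real n + 2) * (real n + 2 + e))"
    by (simp add: nonzero_eq_divide_eq)
  also have "\<dots> = of_real (- (sphere_area (DIM('a) - 1) * legendre_at_0 (DIM('a) - 3) n * ((real n + 1) * (real n + 2)))
      / ((real n + 2) * (real n + 2 + e))) * F \<xi>"
  proof -
    have "- (of_real A * (of_real B * z)) / of_real C = of_real (- (A * B) / C) * z" for A B C :: real and z :: complex
      by simp
    then show ?thesis unfolding 3(1)[OF h2] F2\<xi> .
  qed
  also have "- (sphere_area (DIM('a) - 1) * legendre_at_0 (DIM('a) - 3) n * ((real n + 1) * (real n + 2)))
      / ((real n + 2) * (real n + 2 + e)) = sphere_area (DIM('a) - 1) * legendre_at_0 (DIM('a) - 3) (Suc (Suc n))"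
  proof -
    have "- (s * l * (x * y)) / (y * z) = s * (- x / z * l)" if "y \<noteq> 0" for s l x y z :: real
      using that by simp
    moreover have "real n + 2 \<noteq> 0" by linarith
    ultimately show ?thesis unfolding legendre_at_0.simps e_def by blast
  qed
  finally show ?case .
qed

text \<open>
  The polynomial \<open>F\<close> represents \<open>f\<close> on the unit sphere only; this suffices since almost all points of the
  scaled equator lie there.
\<close>

lemma funk_radon_integrand:
  fixes f F :: "'a \<Rightarrow> complex"
  assumes f [measurable]: "f \<in> borel_measurable borel" and F: "\<And>x. norm x = 1 \<Longrightarrow> f x = F x"
    and p: "polynomial_function F" and t: "\<bar>t\<bar> < 1" and dim: "DIM('a) \<ge> 3"
  shows "(1 / sqrt (1 - t\<^sup>2)) *\<^sub>R (LINT \<eta>|subsphere_measure \<xi> t. f \<eta>)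
    = sqrt (1 - t\<^sup>2) ^ (DIM('a) - 3) *\<^sub>R slice_integral F t"
proof -
  define r where "r = sqrt (1 - t\<^sup>2)"
  have t2: "t\<^sup>2 < 1" using t by (simp add: abs_square_less_1)
  then have r: "r > 0" by (simp add: r_def)
  define g where "g \<omega> = t *\<^sub>R \<xi> + r *\<^sub>R \<omega>" for \<omega>
  have [measurable]: "g \<in> borel_measurable borel" unfolding g_def by measurable
  have "(LINT \<eta>|subsphere_measure \<xi> t. f \<eta>)
    = (LINT \<eta>|density (distr \<sigma> borel g) (\<lambda>_. ennreal (r ^ (DIM('a) - 2))). f \<eta>)"
    unfolding subsphere_measure_equator[OF norm_pole t dim_ge_2] g_def[abs_def] r_def ..
  also have "\<dots> = (LINT \<eta>|distr \<sigma> borel g. r ^ (DIM('a) - 2) *\<^sub>R f \<eta>)"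
    using r by (intro integral_density) auto
  also have "\<dots> = (LINT \<omega>|\<sigma>. r ^ (DIM('a) - 2) *\<^sub>R f (g \<omega>))"
    by (rule integral_distr) measurable
  also have "\<dots> = r ^ (DIM('a) - 2) *\<^sub>R (LINT \<omega>|\<sigma>. f (g \<omega>))" by simp
  also have "(LINT \<omega>|\<sigma>. f (g \<omega>)) = (LINT \<omega>|\<sigma>. F (g \<omega>))"
  proof (rule integral_cong_AE)
    show "AE \<omega> in \<sigma>. f (g \<omega>) = F (g \<omega>)"
      using AE_equator[OF norm_pole dim_ge_2]
    proof eventually_elim
      fix \<omega> assume \<omega>: "norm \<omega> = 1 \<and> \<xi> \<bullet> \<omega> = 0"
      have "g \<omega> \<bullet> g \<omega> = t\<^sup>2 + r\<^sup>2"
        using \<omega> norm_pole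
          by (simp add: g_def inner_add_left inner_add_right inner_commute[of \<omega> \<xi>] norm_eq_1 power2_eq_square)
      then have "norm (g \<omega>) = 1" using t2 by (simp add: norm_eq_1 r_def)
      then show "f (g \<omega>) = F (g \<omega>)" by (rule F)
    qed
    show "(\<lambda>\<omega>. F (g \<omega>)) \<in> borel_measurable \<sigma>" unfolding g_def
      by (rule measurable_polynomial_slice[OF p])
  qed measurable
  also have "\<dots> = slice_integral F t" by (simp add: slice_integral_def g_def r_def)
  finally have "(1 / r) *\<^sub>R (LINT \<eta>|subsphere_measure \<xi> t. f \<eta>) = (1 / r * r ^ (DIM('a) - 2)) *\<^sub>R slice_integral F t"
    by simp
  also have "1 / r * r ^ (DIM('a) - 2) = r ^ (DIM('a) - 3)"
  proof -
    have "DIM('a) - 2 = Suc (DIM('a) - 3)" using dim by arith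
    then show ?thesis using r by simp
  qed
  finally show ?thesis by (simp add: r_def)
qed

lemma weight_deriv:
  assumes "\<bar>t\<bar> < 1"
  shows "((\<lambda>t. sqrt (1 - t\<^sup>2) ^ e) has_field_derivative - (real e * t / (1 - t\<^sup>2)) * sqrt (1 - t\<^sup>2) ^ e) (at t)"
proof (cases e)
  case (Suc i)
  have p: "1 - t\<^sup>2 > 0" using assms by (simp add: abs_square_less_1)
  have "((\<lambda>t. sqrt (1 - t\<^sup>2)) has_field_derivative - t / sqrt (1 - t\<^sup>2)) (at t)"
    using p by (auto intro!: derivative_eq_intros simp: divide_simps)
  from DERIV_power[OF this, of e]
  have "((\<lambda>t. sqrt (1 - t\<^sup>2) ^ e) has_field_derivative real e * (- t / sqrt (1 - t\<^sup>2) * sqrt (1 - t\<^sup>2) ^ i)) (at t)"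
    by (simp add: Suc mult.commute)
  moreover have "real e * (- t / s * s ^ i) = - (real e * t / s\<^sup>2) * s ^ e" if "s > 0" for s
    using that by (simp add: Suc power2_eq_square)
  from this[of "sqrt (1 - t\<^sup>2)"] have "real e * (- t / sqrt (1 - t\<^sup>2) * sqrt (1 - t\<^sup>2) ^ i)
      = - (real e * t / (1 - t\<^sup>2)) * sqrt (1 - t\<^sup>2) ^ e"
    using p by simp
  ultimately show ?thesis by simp
qed simp

text \<open>
  The differential equation of the weighted slice integral \<open>G\<close>, as a first-order system.
\<close>

lemma weighted_slice_deriv:
  fixes e :: nat
  assumes F: "harmonic_of_degree m F" and t: "\<bar>t\<bar> < 1" and dim: "DIM('a) = e + 3"
  defines "P \<equiv> slice_integral F" and "P1 \<equiv> slice_integral (directional_derivative \<xi> F)"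
  defines "w \<equiv> \<lambda>t. sqrt (1 - t\<^sup>2) ^ e"
  defines "G \<equiv> \<lambda>t. w t *\<^sub>R P t"
  defines "G1 \<equiv> \<lambda>t. (w t / (1 - t\<^sup>2)) *\<^sub>R (P1 t - ((m + real e) * t) *\<^sub>R P t)"
  shows "(G has_vector_derivative G1 t) (at t)"
    and "(G1 has_vector_derivative (- 1 / (1 - t\<^sup>2)) *\<^sub>R (((real e - 2) * t) *\<^sub>R G1 t + ((m + 1) * (m + real e)) *\<^sub>R G t)) (at t)"
proof -
  have p: "1 - t\<^sup>2 > 0" using t by (simp add: abs_square_less_1)
  define q where "q = 1 / (1 - t\<^sup>2)"
  define P2 where "P2 = slice_integral (directional_derivative \<xi> (directional_derivative \<xi> F))"
  have dP: "(P has_vector_derivative q *\<^sub>R (P1 t - (m * t) *\<^sub>R P t)) (at t)"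
    using slice_integral_deriv[OF F t] unfolding P_def P1_def
    by (simp add: q_def scaleR_conv_of_real divide_inverse mult.commute)
  have dP1: "(P1 has_vector_derivative q *\<^sub>R (P2 t - ((m - 1) * t) *\<^sub>R P1 t)) (at t)"
    using slice_integral_deriv[OF harmonic_directional_derivative[OF F] t, of \<xi>] unfolding P1_def P2_def
    by (simp add: q_def scaleR_conv_of_real divide_inverse mult.commute)
  have P2: "P2 t = ((2 * m + real e - 1) * t) *\<^sub>R P1 t - (m * (m + real e)) *\<^sub>R P t"
    using slice_integral_gegenbauer[OF F t] unfolding P_def P1_def P2_def dim
    by (simp add: scaleR_conv_of_real algebra_simps)
  have dw: "(w has_field_derivative - (real e * t * q) * w t) (at t)"
    using weight_deriv[OF t, of e] by (simp add: w_def q_def)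
  have "(G has_vector_derivative w t *\<^sub>R (q *\<^sub>R (P1 t - (m * t) *\<^sub>R P t)) + (- (real e * t * q) * w t) *\<^sub>R P t) (at t)"
    unfolding G_def by (rule has_vector_derivative_scaleR[OF dw dP])
  also have "w t *\<^sub>R (q *\<^sub>R (P1 t - (m * t) *\<^sub>R P t)) + (- (real e * t * q) * w t) *\<^sub>R P t = G1 t"
  proof -
    have "w t / (1 - t\<^sup>2) = q * w t" by (simp add: q_def)
    then show ?thesis unfolding G1_def by (simp add: algebra_simps)
  qed
  finally show "(G has_vector_derivative G1 t) (at t)" .
  define w2 where "w2 t = w t / (1 - t\<^sup>2)" for t
  define N where "N t = P1 t - ((m + real e) * t) *\<^sub>R P t" for t
  have "((\<lambda>t. 1 - t\<^sup>2) has_field_derivative - 2 * t) (at t)" by (auto intro!: derivative_eq_intros)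
  from DERIV_divide[OF dw this]
  have "(w2 has_field_derivative (- (real e * t * q) * w t * (1 - t\<^sup>2) - w t * (- 2 * t)) / ((1 - t\<^sup>2) * (1 - t\<^sup>2))) (at t)"
    using p by (simp add: w2_def[abs_def])
  also have "(- (real e * t * q) * w t * (1 - t\<^sup>2) - w t * (- 2 * t)) / ((1 - t\<^sup>2) * (1 - t\<^sup>2)) = - ((real e - 2) * t * q) * w2 t"
  proof -
    have "(- (k * t * (1 / s)) * W * s - W * (- 2 * t)) / (s * s) = - ((k - 2) * t * (1 / s)) * (W / s)"
      if "s \<noteq> 0" for k s W :: real
      using that by (simp add: field_simps)
    then show ?thesis unfolding w2_def q_def using p by simp
  qed
  finally have dw2: "(w2 has_field_derivative - ((real e - 2) * t * q) * w2 t) (at t)" .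
  have "(N has_vector_derivative q *\<^sub>R (P2 t - ((m - 1) * t) *\<^sub>R P1 t)
     - (((m + real e) * t) *\<^sub>R (q *\<^sub>R (P1 t - (m * t) *\<^sub>R P t)) + (m + real e) *\<^sub>R P t)) (at t)"
    unfolding N_def[abs_def]
    by (intro has_vector_derivative_diff dP1 has_vector_derivative_scaleR dP) (auto intro!: derivative_eq_intros)
  also have "q *\<^sub>R (P2 t - ((m - 1) * t) *\<^sub>R P1 t)
     - (((m + real e) * t) *\<^sub>R (q *\<^sub>R (P1 t - (m * t) *\<^sub>R P t)) + (m + real e) *\<^sub>R P t)
     = - ((m + 1) * (m + real e)) *\<^sub>R P t"
  proof -
    have "q *\<^sub>R (P2 t - ((m - 1) * t) *\<^sub>R P1 t) - ((m + real e) * t) *\<^sub>R (q *\<^sub>R (P1 t - (m * t) *\<^sub>R P t))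
      = (- (m * (m + real e)) * (q * (1 - t\<^sup>2))) *\<^sub>R P t"
      unfolding P2 by (simp add: scaleR_conv_of_real algebra_simps power2_eq_square)
    moreover have "q * (1 - t\<^sup>2) = 1" using p by (simp add: q_def)
    ultimately have *: "q *\<^sub>R (P2 t - ((m - 1) * t) *\<^sub>R P1 t) - ((m + real e) * t) *\<^sub>R (q *\<^sub>R (P1 t - (m * t) *\<^sub>R P t))
      = - (m * (m + real e)) *\<^sub>R P t"
      by (simp only: mult_1_right)
    show ?thesis unfolding diff_diff_eq[symmetric] * by (simp add: algebra_simps)
  qed
  finally have dN: "(N has_vector_derivative - ((m + 1) * (m + real e)) *\<^sub>R P t) (at t)" .
  have "(G1 has_vector_derivative w2 t *\<^sub>R (- ((m + 1) * (m + real e)) *\<^sub>R P t) + (- ((real e - 2) * t * q) * w2 t) *\<^sub>R N t) (at t)"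
    using has_vector_derivative_scaleR[OF dw2 dN] by (simp add: G1_def w2_def N_def)
  also have "w2 t *\<^sub>R (- ((m + 1) * (m + real e)) *\<^sub>R P t) + (- ((real e - 2) * t * q) * w2 t) *\<^sub>R N t
     = (- 1 / (1 - t\<^sup>2)) *\<^sub>R (((real e - 2) * t) *\<^sub>R G1 t + ((m + 1) * (m + real e)) *\<^sub>R G t)"
  proof -
    have "G1 t = w2 t *\<^sub>R N t" "G t = w t *\<^sub>R P t" by (simp_all add: G1_def w2_def N_def G_def)
    moreover have "w2 t = q * w t" "- 1 / (1 - t\<^sup>2) = - q" by (simp_all add: w2_def q_def)
    ultimately show ?thesis by (simp add: algebra_simps)
  qed
  finally show "(G1 has_vector_derivative (- 1 / (1 - t\<^sup>2)) *\<^sub>R (((real e - 2) * t) *\<^sub>R G1 t + ((m + 1) * (m + real e)) *\<^sub>R G t)) (at t)" .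
qed

lemma funk_radon_eigenfunction:
  fixes f F :: "'a \<Rightarrow> complex"
  assumes f: "f \<in> borel_measurable borel" and fF: "\<And>x. norm x = 1 \<Longrightarrow> f x = F x"
    and F: "harmonic_of_degree (real n) F" and dim: "DIM('a) \<ge> 3"
  shows "funk_radon j f \<xi> = of_real (funk_radon_eigenvalue DIM('a) j n) * F \<xi>"
proof -
  have p: "polynomial_function F" using F by (simp add: harmonic_of_degree_def)
  define e where "e = DIM('a) - 3"
  have e: "DIM('a) = e + 3" using dim by (simp add: e_def)
  define F1 where "F1 = directional_derivative \<xi> F"
  define G where "G t = sqrt (1 - t\<^sup>2) ^ e *\<^sub>R slice_integral F t" for t
  define G1 where "G1 t = (sqrt (1 - t\<^sup>2) ^ e / (1 - t\<^sup>2)) *\<^sub>R (slice_integral F1 t - ((real n + real e) * t) *\<^sub>R slice_integral F t)" for t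
  define h where "h = legendre_derivs (real e - 2) ((real n + 1) * (real n + real e)) G G1"
  have h: "(h i has_vector_derivative h (Suc i) t) (at t)" if t: "\<bar>t\<bar> < 1" for i t
    unfolding h_def
  proof (rule legendre_derivs_deriv[OF _ _ t])
    fix s :: real assume "\<bar>s\<bar> < 1"
    note D = weighted_slice_deriv[OF F this e]
    show "(G has_vector_derivative G1 s) (at s)"
      using D(1) unfolding G_def[abs_def] G1_def F1_def .
    show "(G1 has_vector_derivative (- 1 / (1 - s\<^sup>2)) *\<^sub>R (((real e - 2) * s) *\<^sub>R G1 s + ((real n + 1) * (real n + real e)) *\<^sub>R G s)) (at s)"
      using D(2) unfolding G_def G1_def[abs_def] F1_def .
  qed
  have "funk_radon j f \<xi> = (- 1) ^ j * h j 0"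
    unfolding funk_radon_def
  proof (subst iterated_vector_derivative_eq[where S = "{-1<..<1}" and h = h])
    show "(1 / sqrt (1 - t\<^sup>2)) *\<^sub>R (LINT \<eta>|subsphere_measure \<xi> t. f \<eta>) = h 0 t" if "t \<in> {-1<..<1}" for t
      using funk_radon_integrand[OF f fF p _ dim, of t] that by (simp add: h_def G_def e_def abs_less_iff)
    show "(h i has_vector_derivative h (Suc i) t) (at t)" if "t \<in> {-1<..<1}" for i t
      using that by (intro h) auto
  qed auto
  also have "(- 1) ^ j * h j 0 = of_real (funk_radon_eigenvalue DIM('a) j n) * F \<xi>"
  proof (induction j rule: induct_nat_012)
    case 0
    have "h 0 0 = slice_integral F 0" by (simp add: h_def G_def)
    then show ?case
      using slice_integral_0[OF dim F] funk_radon_eigenvalue_0[OF dim, of n] by simp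
  next
    case 1
    have "h 1 0 = slice_integral F1 0" by (simp add: h_def G1_def)
    also have "\<dots> = of_real (sphere_area (DIM('a) - 1) * (real n * legendre_at_0 (DIM('a) - 3) (n - 1))) * F \<xi>"
    proof (cases n)
      case 0
      then have "harmonic_of_degree (- 1) F1" using harmonic_directional_derivative[OF F, of \<xi>]
        by (simp add: F1_def)
      then show ?thesis using harmonic_of_degree_minus_1[of F1] 0 by (simp add: slice_integral_def)
    next
      case (Suc k)
      have "harmonic_of_degree (real k) F1"
        using harmonic_directional_derivative[OF F, of \<xi>] Suc by (simp add: F1_def)
      from slice_integral_0[OF dim this]
      have "slice_integral F1 0 = of_real (sphere_area (DIM('a) - 1) * legendre_at_0 (DIM('a) - 3) k) * F1 \<xi>" .
      moreover have "F1 \<xi> = of_real (real n) * F \<xi>" using F by (simp add: F1_def harmonic_of_degree_def)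
      ultimately show ?thesis by (simp add: Suc)
    qed
    finally show ?case
      using funk_radon_eigenvalue_1[OF dim, of n] by simp
  next
    case (ge2 i)
    \<comment> \<open>The coefficient in the recursion of \<open>legendre_derivs\<close> factors.\<close>
    have k: "(real n + 1) * (real n + real e) + (real e - 2) * real i - real i * (real i - 1)
       = (real n + real i + 1) * (real n + real DIM('a) - 3 - real i)"
      unfolding e by (simp add: algebra_simps)
    have "h (Suc (Suc i)) 0 = - ((real n + real i + 1) * (real n + real DIM('a) - 3 - real i)) *\<^sub>R h i 0"
      unfolding k[symmetric] by (simp add: h_def flip: scaleR_minus_left)
    then have "(- 1) ^ Suc (Suc i) * h (Suc (Suc i)) 0
        = of_real (- ((real n + real i + 1) * (real n + real DIM('a) - 3 - real i))) * ((- 1) ^ i * h i 0)"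
      by (simp add: scaleR_conv_of_real)
    also have "\<dots> = of_real (funk_radon_eigenvalue DIM('a) (i + 2) n) * F \<xi>"
      unfolding ge2.IH(1) funk_radon_eigenvalue_step
        by (simp only: of_real_mult of_real_minus mult_minus_left mult.assoc)
    finally show ?case by simp
  qed
  finally show ?thesis .
qed

end

theorem theorem3p2:
  fixes d j :: nat
    and Y :: "nat \<Rightarrow> nat \<Rightarrow> 'a::euclidean_space \<Rightarrow> complex"
  assumes dim: "DIM('a) = d" and d: "d \<ge> 3"
    and basis: "\<And>n. orthonormal_harmonic_basis n (Y n)"
  shows "(\<forall>n. \<forall>k\<in>{1..harmonics_dim n d}. \<forall>\<xi>\<in>sphere 0 1.
            funk_radon j (Y n k) \<xi> = of_real (funk_radon_eigenvalue d j n) * Y n k \<xi>) \<and>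
         (\<forall>n. eigenvalue_cond d j n \<longrightarrow>
            funk_radon_eigenvalue d j n =
              pi powr ((real d - 2) / 2) * (- 1) ^ ((n + j) div 2) * 2 ^ (j + 1) *
              (Gamma ((real n + real j + 1) / 2) /
               Gamma ((real n - real j + real d - 1) / 2)))"
proof (intro conjI allI ballI impI)
  fix n k and \<xi> :: 'a
  assume k: "k \<in> {1..harmonics_dim n d}" and \<xi>: "\<xi> \<in> sphere 0 1"
  interpret pole \<xi> using \<xi> dim d by unfold_locales auto
  have "Y n k \<in> spherical_harmonics n"
    using basis[of n] k dim by (auto simp: orthonormal_harmonic_basis_def Let_def)
  then obtain p where Y: "Y n k = restrict p (sphere 0 1)"
    and p: "polynomial_function p" "\<forall>x. laplacian p x = 0" "\<forall>c::real. \<forall>x. p (c *\<^sub>R x) = of_real c ^ n * p x"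
    unfolding spherical_harmonics_def by blast
  have [measurable]: "p \<in> borel_measurable borel" by (rule borel_measurable_polynomial[OF p(1)])
  have [measurable]: "sphere (0::'a) 1 \<in> sets borel" by simp
  have "Y n k \<in> borel_measurable borel" unfolding Y restrict_def by measurable
  moreover have "Y n k x = p x" if "norm x = 1" for x using that by (simp add: Y)
  ultimately have "funk_radon j (Y n k) \<xi> = of_real (funk_radon_eigenvalue DIM('a) j n) * p \<xi>"
    by (rule funk_radon_eigenfunction) (use spherical_harmonics_harmonic_of_degree[OF p] dim d in auto)
  then show "funk_radon j (Y n k) \<xi> = of_real (funk_radon_eigenvalue d j n) * Y n k \<xi>"
    using \<xi> dim by (simp add: Y)
next
  fix n assume "eigenvalue_cond d j n"
  then show "funk_radon_eigenvalue d j n =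
              pi powr ((real d - 2) / 2) * (- 1) ^ ((n + j) div 2) * 2 ^ (j + 1) *
              (Gamma ((real n + real j + 1) / 2) /
               Gamma ((real n - real j + real d - 1) / 2))"
    by (rule funk_radon_eigenvalue_Gamma[OF d])
qed

end
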